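(* Let $X,Y$ be non-empty sets and let $a$ be a function from $Y$ to $X$. Let $A=\operatorname{im}(a)=\{a_i:i\in I\}$ (with $i\mapsto a_i$ injective), $A_i=a_ia^{-1}$, $\lambda_i=|A_i|$ for $i\in I$, $\Lambda_K=\prod_{k\in K}\lambda_k$ for $K\subseteq I$, $\alpha=\operatorname{rank}(a)=|I|$ and $\beta=|X\setminus\operatorname{im}(a)|$. Let $P^a=\operatorname{Reg}(\mathcal T_{XY}^a)$. Let $f=\binom{F_j}{f_j}_{j\in J}\in P^a$, where $J\subseteq I$ and $f_j\in A_j$ for each $j$ (every $f\in P^a$ has this form), and write $\mu=\operatorname{rank}(f)$. Then: (i) $\widehat R_f^a$ is the union of $\mu^\beta$ $\mathscr R^a$-classes of $P^a$. (ii) $\widehat L_f^a$ is the union of $\Lambda_J$ $\mathscr L^a$-classes of $P^a$. (iii) $\widehat H_f^a$ is the union of $\mu^\beta\Lambda_J$ $\mathscr H^a$-classes of $P^a$, each of which has size $\mu!$. (iv) If $H_{\overline f}$ is a non-group $\mathscr H$-class of $\mathcal T_A$, then each $\mathscr H^a$-class of $P^a$ contained in $\widehat H_f^a$ is a non-group. (v) If $H_{\overline f}$ is a group $\mathscr H$-class of $\mathcal T_A$, then each $\mathscr H^a$-class of $P^a$ contained in $\widehat H_f^a$ is a group isomorphic to the symmetric group $\mathcal S_\mu$. Further, $\widehat H_f^a$ is a $\mu^\beta\times\Lambda_J$ rectangular group over $\mathcal S_\mu$. (vi) $\widehat D_f^a=D_f^a=D_\mu^a=\{g\in P^a:\operatorname{rank}(g)=\mu\}$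 is the union of: (a) $\mu^\beta S(\alpha,\mu)$ $\mathscr R^a$-classes; (b) $\sum_{K\subseteq I,\,|K|=\mu}\Lambda_K$ $\mathscr L^a$-classes; (c) $\mu^\beta S(\alpha,\mu)\sum_{K\subseteq I,\,|K|=\mu}\Lambda_K$ $\mathscr H^a$-classes.
   Context: Maps are written on the right and composed left to right. $\mathcal T_{XY}$ is the set of all (totally defined) functions $X\to Y$; $\mathcal T_{XY}^a$ is the semigroup $(\mathcal T_{XY},\star_a)$ with $f\star_ag=fag$; $\operatorname{Reg}(\mathcal T_{XY}^a)$ is its set of regular elements, which is a subsemigroup. $\mathcal T_A$ is the full transformation semigroup on $A$. $f=\binom{F_j}{f_j}_{j\in J}$ means $X=\bigcup_jF_j$, $\operatorname{im}(f)=\{f_j:j\in J\}$ with the $f_j$ distinct, and $F_j=f_jf^{-1}$. $\operatorname{rank}(f)=|\operatorname{im}(f)|$. There is a surjective homomorphism $P^a\to\mathcal T_A:f\mapsto\overline f=(fa)|_A$. $\mathscr R^a,\mathscr L^a,\mathscr H^a,\mathscr D^a$ are Green's relations on $P^a$ (which are the restrictions to $P^a$ of those on $\mathcal T_{XY}^a$), and $D_f^a$ is the $\mathscr D^a$-class of $f$. For $\mathscr K\in\{\mathscr R,\mathscr L,\mathscr H,\mathscr D\}$ and $f,g\in P^a$, write $f\mathrel{\widehat{\mathscr K}^a}g$ if $\overline f\mathrel{\mathscr K}\overline g$ in $\mathcal T_A$; $\widehat K_f^a$ is the $\widehat{\mathscr K}^a$-class of $f$ in $P^a$. $H_{\overline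 f}$ is the $\mathscr H$-class of $\overline f$ in $\mathcal T_A$. All quantities are cardinals, possibly infinite. $S(\kappa,\mu)$ is the number of equivalence relations with exactly $\mu$ classes on a set of size $\kappa$; $\mu!$ is the size of the symmetric group $\mathcal S_\mu$ on a set of size $\mu$. An $r\times l$ rectangular group over a group $G$ is a semigroup isomorphic to the direct product of $G$ with an $r\times l$ rectangular band (i.e. $U\times V$, $|U|=r$, $|V|=l$, with $(u,v)(u',v')=(u,v')$). *)

theory Defs
  imports "HOL-Algebra.Bij"
begin

unbundle cardinal_syntax

section \<open>Cardinals\<close>

text \<open>Cardinals are represented as in \<^theory>\<open>HOL.BNF_Cardinal_Arithmetic\<close>, that is by well-orders
  such as \<open>|A|\<close>, compared up to \<open>=o\<close>; a set of size \<open>r\<close> is \<open>Field r\<close>.\<close>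

definition card_Prod :: "'i set \<Rightarrow> ('i \<Rightarrow> 'a rel) \<Rightarrow> ('i \<Rightarrow> 'a) rel" where
  "card_Prod K r = |\<Pi>\<^sub>E k\<in>K. Field (r k)|"

definition card_Stirling :: "'a rel \<Rightarrow> 'b rel \<Rightarrow> 'a rel rel" where
  "card_Stirling r s = |{E. equiv (Field r) E \<and> |Field r // E| =o s}|"

definition card_fact :: "'a rel \<Rightarrow> ('a \<Rightarrow> 'a) rel" where
  "card_fact r = |carrier (BijGroup (Field r))|"


section \<open>Semigroups on a carrier set\<close>

definition is_semigroup :: "'a set \<Rightarrow> ('a \<Rightarrow> 'a \<Rightarrow> 'a) \<Rightarrow> bool" where
  "is_semigroup S m \<longleftrightarrow>
     (\<forall>x\<in>S. \<forall>y\<in>S. m x y \<in> S) \<and> (\<forall>x\<in>S. \<forall>y\<in>S. \<forall>z\<in>S. m (m x y) z = m x (m y z))"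

definition semigroup_iso ::
  "'a set \<Rightarrow> ('a \<Rightarrow> 'a \<Rightarrow> 'a) \<Rightarrow> 'b set \<Rightarrow> ('b \<Rightarrow> 'b \<Rightarrow> 'b) \<Rightarrow> bool" where
  "semigroup_iso S m T n \<longleftrightarrow> is_semigroup S m \<and> is_semigroup T n \<and>
     (\<exists>h. bij_betw h S T \<and> (\<forall>x\<in>S. \<forall>y\<in>S. h (m x y) = n (h x) (h y)))"

definition regular_elements :: "'a set \<Rightarrow> ('a \<Rightarrow> 'a \<Rightarrow> 'a) \<Rightarrow> 'a set" where
  "regular_elements S m = {x \<in> S. \<exists>y\<in>S. x = m (m x y) x}"

text \<open>The sets \<open>insert x \<dots>\<close> below are the principal one-sided ideals
  \<open>xS\<^sup>1\<close> and \<open>S\<^sup>1x\<close>.\<close>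

definition green_R :: "'a set \<Rightarrow> ('a \<Rightarrow> 'a \<Rightarrow> 'a) \<Rightarrow> 'a rel" where
  "green_R S m = {(x, y) \<in> S \<times> S. insert x ((\<lambda>s. m x s) ` S) = insert y ((\<lambda>s. m y s) ` S)}"

definition green_L :: "'a set \<Rightarrow> ('a \<Rightarrow> 'a \<Rightarrow> 'a) \<Rightarrow> 'a rel" where
  "green_L S m = {(x, y) \<in> S \<times> S. insert x ((\<lambda>s. m s x) ` S) = insert y ((\<lambda>s. m s y) ` S)}"

definition green_H :: "'a set \<Rightarrow> ('a \<Rightarrow> 'a \<Rightarrow> 'a) \<Rightarrow> 'a rel" where
  "green_H S m = green_R S m \<inter> green_L S m"

text \<open>The least equivalence on \<open>S\<close> containing both relations; reflexivity on \<open>S\<close> and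
  symmetry are inherited from them.\<close>

definition green_D :: "'a set \<Rightarrow> ('a \<Rightarrow> 'a \<Rightarrow> 'a) \<Rightarrow> 'a rel" where
  "green_D S m = (green_R S m \<union> green_L S m)\<^sup>+"

definition is_group :: "'a set \<Rightarrow> ('a \<Rightarrow> 'a \<Rightarrow> 'a) \<Rightarrow> bool" where
  "is_group H m \<longleftrightarrow> (\<exists>e. group \<lparr>carrier = H, mult = m, one = e\<rparr>)"

definition is_group_iso :: "'a set \<Rightarrow> ('a \<Rightarrow> 'a \<Rightarrow> 'a) \<Rightarrow> 'b monoid \<Rightarrow> bool" where
  "is_group_iso H m G \<longleftrightarrow>
     (\<exists>e. group \<lparr>carrier = H, mult = m, one = e\<rparr> \<and> \<lparr>carrier = H, mult = m, one = e\<rparr> \<cong> G)"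

definition rect_band_mult :: "'u \<times> 'v \<Rightarrow> 'u \<times> 'v \<Rightarrow> 'u \<times> 'v" where
  "rect_band_mult p q = (fst p, snd q)"

definition prod_mult ::
  "('a \<Rightarrow> 'a \<Rightarrow> 'a) \<Rightarrow> ('b \<Rightarrow> 'b \<Rightarrow> 'b) \<Rightarrow> 'a \<times> 'b \<Rightarrow> 'a \<times> 'b \<Rightarrow> 'a \<times> 'b" where
  "prod_mult m n p q = (m (fst p) (fst q), n (snd p) (snd q))"

definition is_rectangular_group ::
  "'u rel \<Rightarrow> 'v rel \<Rightarrow> 'g monoid \<Rightarrow> 'a set \<Rightarrow> ('a \<Rightarrow> 'a \<Rightarrow> 'a) \<Rightarrow> bool" where
  "is_rectangular_group r l G S m \<longleftrightarrow>
     semigroup_iso S m (carrier G \<times> (Field r \<times> Field l)) (prod_mult (mult G) rect_band_mult)"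

text \<open>\<open>C\<close> is the union of exactly \<open>k\<close> classes of the equivalence relation \<open>E\<close> on \<open>S\<close>.\<close>

definition union_of_classes :: "'a set \<Rightarrow> 'a rel \<Rightarrow> 'k rel \<Rightarrow> 'a set \<Rightarrow> bool" where
  "union_of_classes S E k C \<longleftrightarrow> (\<exists>\<C> \<subseteq> S // E. C = \<Union>\<C> \<and> |\<C>| =o k)"


section \<open>Sandwich semigroups of transformations\<close>

text \<open>Functions \<open>X \<rightarrow> Y\<close> are the elements of \<open>X \<rightarrow>\<^sub>E Y\<close>. Products are read from left to
  right: \<open>trans_mult A f g\<close> applies \<open>f\<close> first, and \<open>sandwich_mult X a f g\<close> applies \<open>f\<close>,
  then \<open>a\<close>, then \<open>g\<close>.\<close>

definition trans_mult :: "'x set \<Rightarrow> ('x \<Rightarrow> 'x) \<Rightarrow> ('x \<Rightarrow> 'x) \<Rightarrow> ('x \<Rightarrow> 'x)" where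
  "trans_mult A f g = compose A g f"

definition sandwich_mult ::
  "'x set \<Rightarrow> ('y \<Rightarrow> 'x) \<Rightarrow> ('x \<Rightarrow> 'y) \<Rightarrow> ('x \<Rightarrow> 'y) \<Rightarrow> ('x \<Rightarrow> 'y)" where
  "sandwich_mult X a f g = compose X g (compose X a f)"

definition reg_sandwich :: "'x set \<Rightarrow> 'y set \<Rightarrow> ('y \<Rightarrow> 'x) \<Rightarrow> ('x \<Rightarrow> 'y) set" where
  "reg_sandwich X Y a = regular_elements (X \<rightarrow>\<^sub>E Y) (sandwich_mult X a)"

definition bar :: "'y set \<Rightarrow> ('y \<Rightarrow> 'x) \<Rightarrow> ('x \<Rightarrow> 'y) \<Rightarrow> ('x \<Rightarrow> 'x)" where
  "bar Y a f = (\<lambda>x \<in> a ` Y. a (f x))"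

text \<open>The argument \<open>K\<close> is one of the Green relations, e.g. \<^const>\<open>green_R\<close>.\<close>

definition hat_rel ::
  "'x set \<Rightarrow> 'y set \<Rightarrow> ('y \<Rightarrow> 'x) \<Rightarrow>
   (('x \<Rightarrow> 'x) set \<Rightarrow> (('x \<Rightarrow> 'x) \<Rightarrow> ('x \<Rightarrow> 'x) \<Rightarrow> ('x \<Rightarrow> 'x)) \<Rightarrow> ('x \<Rightarrow> 'x) rel) \<Rightarrow>
   ('x \<Rightarrow> 'y) rel" where
  "hat_rel X Y a K =
     {(f, g) \<in> reg_sandwich X Y a \<times> reg_sandwich X Y a.
        (bar Y a f, bar Y a g) \<in> K (a ` Y \<rightarrow>\<^sub>E a ` Y) (trans_mult (a ` Y))}"

end

theory Submission
  imports Defs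
begin

text \<open>A map \<open>f\<close> is regular iff \<open>a\<close> is injective on \<open>f ` X\<close> and \<open>f ` im a = f ` X\<close>, and among
  regular maps \<open>\<R>\<close> means equal kernels, \<open>\<L>\<close> equal images and \<open>\<D>\<close> equal ranks. Since \<open>\<T>\<^sub>A\<close> is
  the sandwich semigroup of the identity of \<open>A\<close>, the same description covers Green's relations there, so
  \<open>f\<close> and \<open>g\<close> are \<open>\<R>\<close>-hat related iff their kernels agree on \<open>A\<close>, and \<open>\<L>\<close>-hat related iff
  \<open>a ` f ` X = a ` g ` X\<close>. An \<open>\<R>\<close>-class in a hat class is then the choice of a kernel class for each point
  of \<open>X - A\<close>, an \<open>\<L>\<close>-class is the choice of a preimage under \<open>a\<close> for each point of \<open>a ` f ` X\<close>, and
  all pairs of choices occur because a map with prescribed kernel and image exists as soon as the ranks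
  agree. In the group case, an element of the hat class is determined by these two choices and by the permutation
  that \<open>g\<close> followed by \<open>a\<close> induces on \<open>a ` f ` X\<close>.\<close>

section \<open>Counting classes and permutation groups\<close>

text \<open>Agreement of the kernels of \<open>u\<close> and \<open>v\<close> on \<open>C\<close>
  makes the assignment \<open>u x\<close> to \<open>v x\<close> both well defined and
  injective.\<close>

lemma card_of_image_ordIso:
  assumes "\<And>x y. x \<in> C \<Longrightarrow> y \<in> C \<Longrightarrow> u x = u y \<longleftrightarrow> v x = v y"
  shows "|u ` C| =o |v ` C|"
proof -
  let ?w = "\<lambda>z. v (inv_into C u z)"
  have "?w (u x) = v x" if "x \<in> C" for x
    using that assms f_inv_into_f[of "u x" u C] inv_into_into[of "u x" u C] by blast
  then have "bij_betw ?w (u ` C) (v ` C)"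
    using assms by (auto simp: bij_betw_def inj_on_def image_iff)
  then show ?thesis
    using card_of_ordIso by blast
qed

text \<open>Classes are counted by a complete invariant: on the closed set \<open>C\<close> the
  values of \<open>F\<close> correspond one to one to the classes. Every count in the theorem is
  reduced to computing the image of such an \<open>F\<close>.\<close>

lemma union_of_classes_invariant:
  assumes "equiv S E" and "C \<subseteq> S" and "E `` C \<subseteq> C"
    and "\<And>x y. x \<in> C \<Longrightarrow> y \<in> C \<Longrightarrow> (x, y) \<in> E \<longleftrightarrow> F x = F y"
    and "|F ` C| =o k"
  shows "union_of_classes S E k C"
  unfolding union_of_classes_def
proof (intro exI conjI)
  let ?Q = "(\<lambda>x. E `` {x}) ` C"
  show "?Q \<subseteq> S // E"
    using assms(2) by (auto simp: quotient_def)
  show "C = \<Union>?Q"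
    using assms(1-3) equiv_class_self by fastforce
  have "E `` {x} = E `` {y} \<longleftrightarrow> F x = F y" if "x \<in> C" "y \<in> C" for x y
    using assms(1,2,4) that by (metis eq_equiv_class_iff subset_iff)
  then have "|?Q| =o |F ` C|"
    by (rule card_of_image_ordIso)
  then show "|?Q| =o k"
    using assms(5) by (rule ordIso_transitive)
qed

text \<open>The group axioms are pulled back along \<open>h\<close>. Inversion in \<open>G\<close>
  reverses products once more, so \<open>h\<close> followed by inversion is an isomorphism.\<close>

lemma is_group_iso_anti:
  assumes "group G" and "bij_betw h S (carrier G)"
    and closed: "\<And>x y. x \<in> S \<Longrightarrow> y \<in> S \<Longrightarrow> m x y \<in> S"
    and anti: "\<And>x y. x \<in> S \<Longrightarrow> y \<in> S \<Longrightarrow> h (m x y) = h y \<otimes>\<^bsub>G\<^esub> h x"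
  shows "is_group_iso S m G"
proof -
  interpret group G by fact
  define e where "e = inv_into S h \<one>\<^bsub>G\<^esub>"
  let ?S = "\<lparr>carrier = S, mult = m, one = e\<rparr>"
  have hS: "h x \<in> carrier G" if "x \<in> S" for x
    using assms(2) that by (auto simp: bij_betw_def)
  have inj: "x = y" if "h x = h y" "x \<in> S" "y \<in> S" for x y
    using assms(2) that by (auto simp: bij_betw_def inj_on_def)
  have surj: "\<exists>x\<in>S. h x = u" if "u \<in> carrier G" for u
    using assms(2) that by (force simp: bij_betw_def)
  have e: "e \<in> S" "h e = \<one>\<^bsub>G\<^esub>"
    using assms(2) unfolding e_def by (auto simp: bij_betw_def inv_into_into f_inv_into_f)
  have "group ?S"
  proof (rule groupI)
    show "x \<otimes>\<^bsub>?S\<^esub> y \<otimes>\<^bsub>?S\<^esub> z = x \<otimes>\<^bsub>?S\<^esub> (y \<otimes>\<^bsub>?S\<^esub> z)"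
      if "x \<in> carrier ?S" "y \<in> carrier ?S" "z \<in> carrier ?S" for x y z
      using that by (intro inj) (simp_all add: closed anti hS m_assoc)
    show "\<one>\<^bsub>?S\<^esub> \<otimes>\<^bsub>?S\<^esub> x = x" if "x \<in> carrier ?S" for x
      using that by (intro inj) (simp_all add: closed anti hS e)
    show "\<exists>y\<in>carrier ?S. y \<otimes>\<^bsub>?S\<^esub> x = \<one>\<^bsub>?S\<^esub>" if x: "x \<in> carrier ?S" for x
    proof -
      obtain y where y: "y \<in> S" "h y = inv\<^bsub>G\<^esub> h x"
        using surj[of "inv\<^bsub>G\<^esub> h x"] x hS by auto
      then have "m y x = e"
        using x by (intro inj) (simp_all add: closed anti hS e)
      with y show ?thesis by auto
    qed
  qed (use closed e in auto)
  moreover have "(\<lambda>x. inv\<^bsub>G\<^esub> h x) \<in> iso ?S G"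
  proof -
    have "bij_betw (\<lambda>u. inv\<^bsub>G\<^esub> u) (carrier G) (carrier G)"
      by (rule bij_betw_byWitness[where f' = "\<lambda>u. inv\<^bsub>G\<^esub> u"]) auto
    then have "bij_betw (\<lambda>x. inv\<^bsub>G\<^esub> h x) S (carrier G)"
      using bij_betw_trans[OF assms(2)] by (simp add: comp_def)
    then show ?thesis
      by (auto simp: iso_def hom_def anti hS inv_mult_group)
  qed
  ultimately show ?thesis
    unfolding is_group_iso_def is_iso_def by blast
qed

section \<open>Permutation groups of equipotent sets\<close>

lemma carrier_BijGroup [simp]: "carrier (BijGroup S) = Bij S"
  by (simp add: BijGroup_def)

lemma mult_BijGroup [simp]: "p \<in> Bij S \<Longrightarrow> q \<in> Bij S \<Longrightarrow> p \<otimes>\<^bsub>BijGroup S\<^esub> q = compose S p q"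
  by (simp add: BijGroup_def)

text \<open>Conjugation by \<open>b\<close>, with conjugation by its inverse as witness of
  bijectivity. Both maps are restricted because elements of \<open>Bij\<close> are
  extensional.\<close>

lemma BijGroup_iso:
  assumes b: "bij_betw b N M"
  shows "(\<lambda>p. \<lambda>y\<in>M. b (p (inv_into N b y))) \<in> iso (BijGroup N) (BijGroup M)" (is "?c \<in> _")
proof -
  let ?b' = "inv_into N b"
  let ?d = "\<lambda>q. \<lambda>x\<in>N. ?b' (q (b x))"
  have b': "bij_betw ?b' M N"
    using b by (rule bij_betw_inv_into)
  have in_M: "b x \<in> M" and b'b: "?b' (b x) = x" if "x \<in> N" for x
    using b that by (auto simp: bij_betw_def)
  have in_N: "?b' y \<in> N" and bb': "b (?b' y) = y" if "y \<in> M" for y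
    using b b' that by (auto simp: bij_betw_def f_inv_into_f inv_into_into)
  have c: "?c p \<in> Bij M" if "p \<in> Bij N" for p
    using bij_betw_trans[OF b' bij_betw_trans[OF _ b, of p N]] that
    by (auto simp: Bij_def comp_def cong: bij_betw_cong)
  have d: "?d q \<in> Bij N" if "q \<in> Bij M" for q
    using bij_betw_trans[OF b bij_betw_trans[OF _ b', of q M]] that
    by (auto simp: Bij_def comp_def cong: bij_betw_cong)
  have mem: "p x \<in> S" if "p \<in> Bij S" "x \<in> S" for p and S :: "'z set" and x
    using that Bij_imp_funcset by blast
  have "?d (?c p) = p" if "p \<in> Bij N" for p
    using that by (auto simp: fun_eq_iff in_M b'b mem Bij_def extensional_def)
  moreover have "?c (?d q) = q" if "q \<in> Bij M" for q
    using that by (auto simp: fun_eq_iff in_N bb' mem Bij_def extensional_def)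
  ultimately have "bij_betw ?c (Bij N) (Bij M)"
    using c d by (intro bij_betw_byWitness[where f' = ?d]) auto
  moreover have "?c (compose N p q) = compose M (?c p) (?c q)" if "p \<in> Bij N" "q \<in> Bij N" for p q
    using that by (auto simp: fun_eq_iff compose_def in_N in_M b'b mem)
  ultimately show ?thesis
    using c by (auto simp: iso_def hom_def compose_Bij)
qed

lemma is_group_iso_trans: "is_group_iso S m G \<Longrightarrow> G \<cong> K \<Longrightarrow> is_group_iso S m K"
  unfolding is_group_iso_def by (blast intro: iso_trans)

lemma is_group_iso_imp_is_group: "is_group_iso S m G \<Longrightarrow> is_group S m"
  by (auto simp: is_group_iso_def is_group_def)


section \<open>Kernels of maps and their quotients\<close>

text \<open>The domain is a parameter because Green's relations on \<open>P\<close> depend on the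
  kernel on \<open>X\<close>, while the hat relations only see the kernel on
  \<open>A\<close>.\<close>

definition kernel_on :: "'x set \<Rightarrow> ('x \<Rightarrow> 'y) \<Rightarrow> 'x rel" where
  "kernel_on S f = {(x, y) \<in> S \<times> S. f x = f y}"

lemma kernel_on_eq_iff:
  "kernel_on S f = kernel_on S g \<longleftrightarrow> (\<forall>x\<in>S. \<forall>y\<in>S. f x = f y \<longleftrightarrow> g x = g y)"
  by (auto simp: kernel_on_def)

lemma kernel_on_eqD:
  "kernel_on S f = kernel_on S g \<Longrightarrow> x \<in> S \<Longrightarrow> y \<in> S \<Longrightarrow> f x = f y \<longleftrightarrow> g x = g y"
  by (simp add: kernel_on_eq_iff)

lemma kernel_on_mono:
  "kernel_on S f = kernel_on S g \<Longrightarrow> T \<subseteq> S \<Longrightarrow> kernel_on T f = kernel_on T g"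
  unfolding kernel_on_eq_iff by blast

lemma equiv_kernel_on: "equiv S (kernel_on S f)"
  by (auto simp: kernel_on_def intro!: equivI refl_onI symI transI)

lemma card_of_quotient_kernel_on: "|S // kernel_on S f| =o |f ` S|"
proof -
  have "S // kernel_on S f = (\<lambda>x. kernel_on S f `` {x}) ` S"
    by (auto simp: quotient_def)
  moreover have "|(\<lambda>x. kernel_on S f `` {x}) ` S| =o |f ` S|"
    by (rule card_of_image_ordIso) (auto simp: kernel_on_def)
  ultimately show ?thesis by simp
qed

lemma card_of_image_kernel_on: "kernel_on S f = kernel_on S g \<Longrightarrow> |f ` S| =o |g ` S|"
  using card_of_image_ordIso kernel_on_eqD by metis


section \<open>Green's relations on the regular elements\<close>

locale sandwich =
  fixes X :: "'x set" and Y :: "'y set" and a :: "'y \<Rightarrow> 'x"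
  assumes a_in: "y \<in> Y \<Longrightarrow> a y \<in> X"
begin

abbreviation A where "A \<equiv> a ` Y"
abbreviation P where "P \<equiv> reg_sandwich X Y a"
abbreviation star (infixl \<open>\<star>\<close> 70) where "f \<star> g \<equiv> sandwich_mult X a f g"

lemma A_subset: "A \<subseteq> X"
  using a_in by auto

lemma star_apply [simp]: "x \<in> X \<Longrightarrow> (f \<star> g) x = g (a (f x))"
  by (simp add: sandwich_mult_def compose_eq)

lemma star_ext: "x \<notin> X \<Longrightarrow> (f \<star> g) x = undefined"
  by (simp add: sandwich_mult_def compose_def)

lemma star_in: "f \<in> X \<rightarrow>\<^sub>E Y \<Longrightarrow> g \<in> X \<rightarrow>\<^sub>E Y \<Longrightarrow> f \<star> g \<in> X \<rightarrow>\<^sub>E Y"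
  using a_in by (auto simp: sandwich_mult_def compose_def PiE_iff)

lemma star_assoc: "f \<in> X \<rightarrow>\<^sub>E Y \<Longrightarrow> g \<in> X \<rightarrow>\<^sub>E Y \<Longrightarrow> f \<star> g \<star> h = f \<star> (g \<star> h)"
  using a_in by (auto simp: sandwich_mult_def compose_def PiE_iff fun_eq_iff)

text \<open>Reading \<open>f = f \<star> g \<star> f\<close> at \<open>x\<close> shows that
  \<open>a (f x)\<close> determines \<open>f x\<close>, and that the value \<open>f x\<close> is
  attained at \<open>a (g (a (f x)))\<close>, a point of \<open>A\<close>.\<close>

lemma P_D:
  assumes "f \<in> P"
  shows P_in: "f \<in> X \<rightarrow>\<^sub>E Y" and P_inj: "inj_on a (f ` X)" and P_image: "f ` A = f ` X"
    and "\<exists>g \<in> X \<rightarrow>\<^sub>E Y. f = f \<star> g \<star> f"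
proof -
  obtain g where f: "f \<in> X \<rightarrow>\<^sub>E Y" and g: "g \<in> X \<rightarrow>\<^sub>E Y" and fgf: "f = f \<star> g \<star> f"
    using assms by (auto simp: reg_sandwich_def regular_elements_def)
  have *: "f x = f (a (g (a (f x))))" if "x \<in> X" for x
    using star_apply[OF that] fgf that by metis
  show "f \<in> X \<rightarrow>\<^sub>E Y" "\<exists>g \<in> X \<rightarrow>\<^sub>E Y. f = f \<star> g \<star> f"
    using f g fgf by blast+
  show "inj_on a (f ` X)"
  proof (rule inj_onI, clarify)
    fix x y assume "x \<in> X" "y \<in> X" "a (f x) = a (f y)"
    then show "f x = f y"
      using *[of x] *[of y] by simp
  qed
  have "a (g (a (f x))) \<in> A" if "x \<in> X" for x
    using f g that a_in by (auto simp: PiE_iff)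
  then have "f x \<in> f ` A" if "x \<in> X" for x
    using *[OF that] that by (metis imageI)
  then show "f ` A = f ` X"
    using A_subset by blast
qed

text \<open>An inverse is built in two choices: \<open>s\<close> moves any argument to a point of
  \<open>Y\<close> whose \<open>a\<close>-image has the same value under \<open>f\<close>, and
  injectivity of \<open>a\<close> makes it harmless which preimage of \<open>a (f x)\<close> is
  taken.\<close>

lemma P_I:
  assumes f: "f \<in> X \<rightarrow>\<^sub>E Y" and inj: "inj_on a (f ` X)" and im: "f ` X \<subseteq> f ` A"
  shows "f \<in> P"
proof -
  have "\<forall>x\<in>X. \<exists>y\<in>Y. f (a y) = f x"
    using im by force
  then obtain s where s: "\<And>x. x \<in> X \<Longrightarrow> s x \<in> Y \<and> f (a (s x)) = f x"
    by metis
  \<comment> \<open>The else branch only serves to keep the values of \<open>g\<close> in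
    \<open>Y\<close>; those arguments are never reached in
    \<open>f \<star> g \<star> f\<close>.\<close>
  define g where "g = (\<lambda>z\<in>X. s (if z \<in> a ` f ` X then inv_into X (\<lambda>x. a (f x)) z else z))"
  have "f (a (g (a (f x)))) = f x" if x: "x \<in> X" for x
  proof -
    let ?x = "inv_into X (\<lambda>x. a (f x)) (a (f x))"
    have "?x \<in> X" "a (f ?x) = a (f x)"
      using x by (auto intro!: inv_into_into f_inv_into_f[where f = "\<lambda>x. a (f x)"])
    moreover from this have "f ?x = f x"
      using inj x by (auto dest: inj_onD)
    moreover have "a (f x) \<in> X"
      using f a_in x by auto
    ultimately show ?thesis
      using s x by (simp add: g_def image_iff) metis
  qed
  moreover have "g \<in> X \<rightarrow>\<^sub>E Y"
  proof -
    have "inv_into X (\<lambda>x. a (f x)) z \<in> X" if "z \<in> a ` f ` X" for z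
      using that by (intro inv_into_into) (simp add: image_image)
    then show ?thesis
      using s by (auto simp: g_def)
  qed
  moreover have "f x = (f \<star> g \<star> f) x" for x
    using calculation f by (cases "x \<in> X") (auto simp: star_ext)
  ultimately have "\<exists>g \<in> X \<rightarrow>\<^sub>E Y. f = f \<star> g \<star> f"
    by blast
  then show ?thesis
    using f unfolding reg_sandwich_def regular_elements_def by blast
qed

lemma P_ext: "f \<in> P \<Longrightarrow> g \<in> P \<Longrightarrow> (\<And>x. x \<in> X \<Longrightarrow> f x = g x) \<Longrightarrow> f = g"
  using P_in PiE_ext by metis

lemma P_apply: "f \<in> P \<Longrightarrow> x \<in> X \<Longrightarrow> f x \<in> Y"
  using P_in by auto

lemma P_a_apply: "f \<in> P \<Longrightarrow> x \<in> X \<Longrightarrow> a (f x) \<in> A"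
  using P_apply by auto

lemma P_a_eq: "f \<in> P \<Longrightarrow> x \<in> X \<Longrightarrow> y \<in> X \<Longrightarrow> a (f x) = a (f y) \<longleftrightarrow> f x = f y"
  using P_inj by (auto dest: inj_onD)

lemma P_obtain_A:
  assumes "f \<in> P" "x \<in> X"
  obtains z where "z \<in> A" "f z = f x"
  using P_image[OF assms(1)] assms(2) by (metis imageE imageI)

lemma star_P:
  assumes f: "f \<in> P" and g: "g \<in> P"
  shows "f \<star> g \<in> P"
proof (rule P_I)
  show "f \<star> g \<in> X \<rightarrow>\<^sub>E Y"
    using f g P_in star_in by blast
  have "(f \<star> g) ` X \<subseteq> g ` X"
    using P_a_apply[OF f] A_subset by auto
  then show "inj_on a ((f \<star> g) ` X)"
    using P_inj[OF g] inj_on_subset by blast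
  show "(f \<star> g) ` X \<subseteq> (f \<star> g) ` A"
  proof clarify
    fix x assume x: "x \<in> X"
    obtain z where "z \<in> A" "f z = f x"
      using P_obtain_A[OF f x] .
    then show "(f \<star> g) x \<in> (f \<star> g) ` A"
      using x A_subset by (intro image_eqI[of _ _ z]) auto
  qed
qed

text \<open>Regularity supplies an inverse \<open>g\<close> among all maps, whereas Green's
  relations of \<open>P\<close> need factors in \<open>P\<close>. Replacing \<open>g\<close> by
  \<open>g \<star> f \<star> g\<close> gives an inverse that is itself regular, with
  \<open>f\<close> as its inverse.\<close>

lemma inverse_P:
  assumes f: "f \<in> P"
  obtains g where "g \<in> P" "f \<star> g \<star> f = f"
proof -
  obtain g where g: "g \<in> X \<rightarrow>\<^sub>E Y" "f = f \<star> g \<star> f"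
    using P_D(4)[OF f] by blast
  note f' = P_in[OF f]
  have fgf: "f \<star> (g \<star> f) = f"
    using g f' by (simp add: star_assoc)
  let ?h = "g \<star> f \<star> g"
  have h: "?h \<in> X \<rightarrow>\<^sub>E Y"
    using g f' by (simp add: star_in)
  have "f \<star> ?h = f \<star> g"
    using g f' by (metis star_assoc star_in)
  then have "?h \<star> f \<star> ?h = ?h" and fhf: "f \<star> ?h \<star> f = f"
    using g f' h by (metis star_assoc star_in)+
  then have "?h \<in> P"
    using h f' unfolding reg_sandwich_def regular_elements_def by (auto intro!: bexI[of _ f])
  then show thesis
    using fhf that by blast
qed

section \<open>Green's relations on \<open>P\<close> in terms of kernels, images and ranks\<close>

text \<open>Right multiplication can only enlarge the kernel. Conversely, if the kernels agree and
  \<open>g'\<close> is an inverse of \<open>g\<close>, then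
  \<open>f = g \<star> (g' \<star> f)\<close>.\<close>

lemma green_R_iff:
  "(f, g) \<in> green_R P (\<star>) \<longleftrightarrow> f \<in> P \<and> g \<in> P \<and> kernel_on X f = kernel_on X g"
proof -
  have le: "kernel_on X g \<subseteq> kernel_on X f" if "f \<in> insert g ((\<lambda>s. g \<star> s) ` P)" for f g
    using that by (auto simp: kernel_on_def)
  have ex: "\<exists>s\<in>P. f = g \<star> s" if f: "f \<in> P" and g: "g \<in> P" and eq: "kernel_on X f = kernel_on X g" for f g
  proof -
    obtain g' where g': "g' \<in> P" "g \<star> g' \<star> g = g"
      using inverse_P[OF g] .
    have "f x = (g \<star> (g' \<star> f)) x" if x: "x \<in> X" for x
    proof -
      \<comment> \<open>This point lies in the kernel class of \<open>x\<close> under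
        \<open>g\<close>, hence under \<open>f\<close>, so \<open>f\<close> takes the same value at
        both.\<close>
      let ?y = "a (g' (a (g x)))"
      have "a (g x) \<in> X" "?y \<in> X"
        using P_apply g g'(1) x a_in by auto
      moreover from this have "g ?y = g x"
        using fun_cong[OF g'(2), of x] x by simp
      ultimately show ?thesis
        using kernel_on_eqD[OF eq, of ?y x] x by simp
    qed
    moreover have "g' \<star> f \<in> P" "g \<star> (g' \<star> f) \<in> P"
      using f g g' star_P by blast+
    ultimately show ?thesis
      using P_ext f by blast
  qed
  have sub: "insert f ((\<lambda>s. f \<star> s) ` P) \<subseteq> insert g ((\<lambda>s. g \<star> s) ` P)"
    if f: "f \<in> P" and g: "g \<in> P" and eq: "kernel_on X f = kernel_on X g" for f g
  proof -
    obtain s where s: "s \<in> P" "f = g \<star> s"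
      using ex[OF f g eq] by blast
    have "f \<star> t \<in> (\<lambda>s. g \<star> s) ` P" if "t \<in> P" for t
      using s g that by (intro image_eqI[of _ _ "s \<star> t"]) (auto simp: star_assoc P_in star_P)
    then show ?thesis
      using s by blast
  qed
  show ?thesis
  proof
    assume "(f, g) \<in> green_R P (\<star>)"
    then have "f \<in> P" "g \<in> P" "insert f ((\<lambda>s. f \<star> s) ` P) = insert g ((\<lambda>s. g \<star> s) ` P)"
      by (auto simp: green_R_def)
    then show "f \<in> P \<and> g \<in> P \<and> kernel_on X f = kernel_on X g"
      using le[of f g] le[of g f] by blast
  next
    assume *: "f \<in> P \<and> g \<in> P \<and> kernel_on X f = kernel_on X g"
    have "insert f ((\<lambda>s. f \<star> s) ` P) = insert g ((\<lambda>s. g \<star> s) ` P)"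
      by (intro subset_antisym sub) (use * in auto)
    then show "(f, g) \<in> green_R P (\<star>)"
      using * by (simp add: green_R_def)
  qed
qed

text \<open>Left multiplication can only shrink the image. Conversely, if the images agree, every
  \<open>f x\<close> is some \<open>g w\<close>, and \<open>g' \<star> g\<close> acts as the
  identity on such values, so \<open>f = f \<star> g' \<star> g\<close>.\<close>

lemma green_L_iff:
  "(f, g) \<in> green_L P (\<star>) \<longleftrightarrow> f \<in> P \<and> g \<in> P \<and> f ` X = g ` X"
proof -
  have le: "f ` X \<subseteq> g ` X" if "g \<in> P" "f \<in> insert g ((\<lambda>s. s \<star> g) ` P)" for f g
    using that a_in P_apply by auto
  have ex: "\<exists>s\<in>P. f = s \<star> g" if f: "f \<in> P" and g: "g \<in> P" and eq: "f ` X = g ` X" for f g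
  proof -
    obtain g' where g': "g' \<in> P" "g \<star> g' \<star> g = g"
      using inverse_P[OF g] .
    have "f x = (f \<star> g' \<star> g) x" if x: "x \<in> X" for x
    proof -
      obtain w where w: "w \<in> X" "f x = g w"
        using eq x by blast
      have "a (g w) \<in> X"
        using P_apply g w a_in by auto
      then show ?thesis
        using fun_cong[OF g'(2), of w] w x by simp
    qed
    moreover have "f \<star> g' \<in> P" "f \<star> g' \<star> g \<in> P"
      using f g g' star_P by blast+
    ultimately show ?thesis
      using P_ext f by blast
  qed
  have sub: "insert f ((\<lambda>s. s \<star> f) ` P) \<subseteq> insert g ((\<lambda>s. s \<star> g) ` P)"
    if f: "f \<in> P" and g: "g \<in> P" and eq: "f ` X = g ` X" for f g
  proof -
    obtain s where s: "s \<in> P" "f = s \<star> g"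
      using ex[OF f g eq] by blast
    have "t \<star> f \<in> (\<lambda>s. s \<star> g) ` P" if "t \<in> P" for t
      using s g that by (intro image_eqI[of _ _ "t \<star> s"]) (auto simp: star_assoc P_in star_P)
    then show ?thesis
      using s by blast
  qed
  show ?thesis
  proof
    assume "(f, g) \<in> green_L P (\<star>)"
    then have "f \<in> P" "g \<in> P" "insert f ((\<lambda>s. s \<star> f) ` P) = insert g ((\<lambda>s. s \<star> g) ` P)"
      by (auto simp: green_L_def)
    then show "f \<in> P \<and> g \<in> P \<and> f ` X = g ` X"
      using le[of f g] le[of g f] by blast
  next
    assume *: "f \<in> P \<and> g \<in> P \<and> f ` X = g ` X"
    have "insert f ((\<lambda>s. s \<star> f) ` P) = insert g ((\<lambda>s. s \<star> g) ` P)"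
      by (intro subset_antisym sub) (use * in auto)
    then show "(f, g) \<in> green_L P (\<star>)"
      using * by (simp add: green_L_def)
  qed
qed

lemma green_H_iff:
  "(f, g) \<in> green_H P (\<star>) \<longleftrightarrow> f \<in> P \<and> g \<in> P \<and> kernel_on X f = kernel_on X g \<and> f ` X = g ` X"
  by (auto simp: green_H_def green_R_iff green_L_iff)

lemma equiv_green_R: "equiv P (green_R P (\<star>))"
  by (auto simp: green_R_iff intro!: equivI refl_onI symI transI)

lemma equiv_green_L: "equiv P (green_L P (\<star>))"
  by (auto simp: green_L_iff intro!: equivI refl_onI symI transI)

lemma equiv_green_H: "equiv P (green_H P (\<star>))"
  by (auto simp: green_H_iff intro!: equivI refl_onI symI transI)

text \<open>Renaming the values of a regular map by a bijection leaves its kernel alone and only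
  changes its image. Most maps with a prescribed image below are obtained in this way.\<close>

lemma relabel_P:
  assumes f: "f \<in> P" and \<sigma>: "bij_betw \<sigma> (f ` X) M" and M: "M \<subseteq> Y" "inj_on a M"
  defines "g \<equiv> \<lambda>x\<in>X. \<sigma> (f x)"
  shows "g \<in> P" and "kernel_on X g = kernel_on X f" and "g ` X = M"
proof -
  show im: "g ` X = M"
    using \<sigma> by (auto simp: g_def bij_betw_def)
  show "kernel_on X g = kernel_on X f"
    using \<sigma> by (auto simp: g_def kernel_on_def bij_betw_def inj_on_def)
  show "g \<in> P"
  proof (rule P_I)
    show "g \<in> X \<rightarrow>\<^sub>E Y"
      using im M by (auto simp: g_def)
    show "inj_on a (g ` X)"
      using im M by simp
    have "g ` A = \<sigma> ` f ` A"
      using A_subset by (auto simp: g_def subset_iff image_iff)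
    then show "g ` X \<subseteq> g ` A"
      using P_image[OF f] by (auto simp: g_def)
  qed
qed

lemma P_meet:
  assumes f: "f \<in> P" and g: "g \<in> P" and "|f ` X| =o |g ` X|"
  obtains h where "h \<in> P" "kernel_on X h = kernel_on X f" "h ` X = g ` X"
proof -
  obtain \<sigma> where "bij_betw \<sigma> (f ` X) (g ` X)"
    using assms(3) card_of_ordIso by blast
  moreover have "g ` X \<subseteq> Y" "inj_on a (g ` X)"
    using P_apply P_inj g by auto
  ultimately show thesis
    using relabel_P[OF f] that[of "\<lambda>x\<in>X. \<sigma> (f x)"] by metis
qed

text \<open>Each single step preserves the rank. For equal ranks, the map \<open>h\<close> with the
  kernel of \<open>f\<close> and the image of \<open>g\<close> shows that one \<R>-step followed by
  one \<L>-step suffices.\<close>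

lemma green_D_iff:
  "(f, g) \<in> green_D P (\<star>) \<longleftrightarrow> f \<in> P \<and> g \<in> P \<and> |f ` X| =o |g ` X|"
proof
  have step1: "f \<in> P \<and> g \<in> P \<and> |f ` X| =o |g ` X|" if "(f, g) \<in> green_R P (\<star>) \<union> green_L P (\<star>)" for f g
    using that by (auto simp: green_R_iff green_L_iff card_of_image_kernel_on)
  assume "(f, g) \<in> green_D P (\<star>)"
  then show "f \<in> P \<and> g \<in> P \<and> |f ` X| =o |g ` X|"
    unfolding green_D_def
  proof (induction rule: trancl_induct)
    case (base y)
    then show ?case by (rule step1)
  next
    case (step y z)
    then show ?case
      using step1[OF step(2)] ordIso_transitive by blast
  qed
next
  assume *: "f \<in> P \<and> g \<in> P \<and> |f ` X| =o |g ` X|"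
  then obtain h where "h \<in> P" "kernel_on X h = kernel_on X f" "h ` X = g ` X"
    using P_meet by blast
  with * have "(f, h) \<in> green_R P (\<star>)" "(h, g) \<in> green_L P (\<star>)"
    by (auto simp: green_R_iff green_L_iff)
  then show "(f, g) \<in> green_D P (\<star>)"
    unfolding green_D_def by (meson UnI1 UnI2 r_into_trancl' trancl_into_trancl)
qed

end


section \<open>Hat relations and group classes\<close>

lemma trans_mult_eq_sandwich_mult: "trans_mult S = sandwich_mult S id"
  by (auto simp: trans_mult_def sandwich_mult_def compose_def fun_eq_iff)

lemma sandwich_id: "sandwich S S id"
  by unfold_locales simp

text \<open>For \<open>id\<close> both conditions of \<open>P_I\<close> hold trivially, so the
  descriptions of Green's relations apply to all transformations of \<open>S\<close>.\<close>

lemma reg_sandwich_id: "reg_sandwich S S id = S \<rightarrow>\<^sub>E S"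
proof
  show "reg_sandwich S S id \<subseteq> S \<rightarrow>\<^sub>E S"
    using sandwich.P_in[OF sandwich_id] by blast
  show "S \<rightarrow>\<^sub>E S \<subseteq> reg_sandwich S S id"
    by (intro subsetI sandwich.P_I[OF sandwich_id]) simp_all
qed

lemmas green_R_transformations_iff =
  sandwich.green_R_iff[OF sandwich_id, unfolded reg_sandwich_id, folded trans_mult_eq_sandwich_mult]
lemmas green_L_transformations_iff =
  sandwich.green_L_iff[OF sandwich_id, unfolded reg_sandwich_id, folded trans_mult_eq_sandwich_mult]
lemmas green_H_transformations_iff =
  sandwich.green_H_iff[OF sandwich_id, unfolded reg_sandwich_id, folded trans_mult_eq_sandwich_mult]
lemmas green_D_transformations_iff =
  sandwich.green_D_iff[OF sandwich_id, unfolded reg_sandwich_id, folded trans_mult_eq_sandwich_mult]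


context sandwich
begin

section \<open>The hat classes in terms of kernels on \<open>A\<close> and images under
  \<open>a\<close>\<close>

lemma bar_in: "f \<in> P \<Longrightarrow> bar Y a f \<in> A \<rightarrow>\<^sub>E A"
  using P_a_apply A_subset by (auto simp: bar_def)

lemma bar_apply: "z \<in> A \<Longrightarrow> bar Y a f z = a (f z)"
  by (simp add: bar_def)

lemma bar_eq_iff: "f \<in> P \<Longrightarrow> z \<in> A \<Longrightarrow> w \<in> A \<Longrightarrow> bar Y a f z = bar Y a f w \<longleftrightarrow> f z = f w"
  using P_a_eq[of f z w] A_subset by (auto simp: bar_apply subset_iff)

lemma kernel_on_bar: "f \<in> P \<Longrightarrow> kernel_on A (bar Y a f) = kernel_on A f"
  by (simp add: kernel_on_eq_iff bar_eq_iff)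

text \<open>Restricting to \<open>A\<close> loses no values, because a regular map attains all of
  them there.\<close>

lemma image_bar: "f \<in> P \<Longrightarrow> bar Y a f ` A = a ` f ` X"
proof -
  have "bar Y a f ` A = a ` f ` A"
    by (simp add: bar_def image_image)
  then show "f \<in> P \<Longrightarrow> ?thesis"
    by (simp only: P_image)
qed

lemma card_of_image_a: "f \<in> P \<Longrightarrow> |a ` f ` X| =o |f ` X|"
  using card_of_ordIso inj_on_imp_bij_betw[OF P_inj] ordIso_symmetric by blast

lemma card_of_image_Rhat:
  "f \<in> P \<Longrightarrow> g \<in> P \<Longrightarrow> kernel_on A g = kernel_on A f \<Longrightarrow> |g ` X| =o |f ` X|"
  using card_of_image_kernel_on[of A g f] P_image by simp

lemma card_of_image_Lhat:
  assumes "f \<in> P" and "g \<in> P" and eq: "a ` g ` X = a ` f ` X"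
  shows "|g ` X| =o |f ` X|"
  using ordIso_transitive[OF ordIso_symmetric[OF card_of_image_a[OF assms(2), unfolded eq]]
      card_of_image_a[OF assms(1)]] .

lemma hat_R: "f \<in> P \<Longrightarrow> hat_rel X Y a green_R `` {f} = {g \<in> P. kernel_on A g = kernel_on A f}"
  by (rule Set.set_eqI) (simp add: hat_rel_def green_R_transformations_iff bar_in kernel_on_bar eq_commute
      cong: conj_cong)

lemma hat_L: "f \<in> P \<Longrightarrow> hat_rel X Y a green_L `` {f} = {g \<in> P. a ` g ` X = a ` f ` X}"
  by (rule Set.set_eqI) (simp add: hat_rel_def green_L_transformations_iff bar_in image_bar eq_commute
      cong: conj_cong)

lemma hat_H: "f \<in> P \<Longrightarrow> hat_rel X Y a green_H `` {f} =
    {g \<in> P. kernel_on A g = kernel_on A f \<and> a ` g ` X = a ` f ` X}"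
  by (rule Set.set_eqI) (simp add: hat_rel_def green_H_transformations_iff bar_in kernel_on_bar image_bar
      eq_commute cong: conj_cong)

text \<open>The map \<open>a\<close> is injective on the image of a regular map, so passing to
  \<open>bar\<close> preserves the rank.\<close>

lemma hat_D:
  assumes f: "f \<in> P"
  shows "hat_rel X Y a green_D `` {f} = {g \<in> P. |g ` X| =o |f ` X|}"
proof -
  have "|a ` f ` X| =o |a ` g ` X| \<longleftrightarrow> |g ` X| =o |f ` X|" if "g \<in> P" for g
    using card_of_image_a[OF f] card_of_image_a[OF that]
    by (meson ordIso_symmetric ordIso_transitive)
  then show ?thesis
    using f by (intro Set.set_eqI) (simp add: hat_rel_def green_D_transformations_iff bar_in image_bar
        cong: conj_cong)
qed

lemma green_D_Image: "f \<in> P \<Longrightarrow> green_D P (\<star>) `` {f} = {g \<in> P. |g ` X| =o |f ` X|}"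
  using ordIso_symmetric by (auto simp: green_D_iff)

text \<open>The maps with the kernel and image of \<open>g\<close> are exactly the maps
  \<open>g\<close> followed by a permutation of its image.\<close>

lemma card_of_green_H:
  assumes g: "g \<in> P"
  shows "|green_H P (\<star>) `` {g}| =o |Bij (g ` X)|"
proof -
  let ?s = "\<lambda>\<sigma>. \<lambda>x\<in>X. \<sigma> (g x)"
  have "bij_betw ?s (Bij (g ` X)) (green_H P (\<star>) `` {g})"
    unfolding bij_betw_def
  proof (intro conjI inj_onI subset_antisym subsetI)
    fix \<sigma> \<tau> assume *: "\<sigma> \<in> Bij (g ` X)" "\<tau> \<in> Bij (g ` X)" "?s \<sigma> = ?s \<tau>"
    then have "\<sigma> y = \<tau> y" if "y \<in> g ` X" for y
    proof -
      obtain x where "x \<in> X" "y = g x"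
        using \<open>y \<in> g ` X\<close> by blast
      then show ?thesis
        using fun_cong[OF *(3), of x] by simp
    qed
    then show "\<sigma> = \<tau>"
      using * Bij_imp_extensional extensionalityI by metis
  next
    fix h assume "h \<in> ?s ` Bij (g ` X)"
    then obtain \<sigma> where "\<sigma> \<in> Bij (g ` X)" "h = ?s \<sigma>"
      by blast
    then show "h \<in> green_H P (\<star>) `` {g}"
      using relabel_P[OF g, of \<sigma> "g ` X"] g P_apply[OF g] P_inj[OF g]
      by (auto simp: green_H_iff Bij_def)
  next
    fix h assume "h \<in> green_H P (\<star>) `` {g}"
    then have h: "h \<in> P" and ker: "kernel_on X g = kernel_on X h" and im: "g ` X = h ` X"
      by (auto simp: green_H_iff)
    \<comment> \<open>The permutation is read off from \<open>h\<close> at one preimage of each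
      value; the choice does not matter since the kernels agree.\<close>
    let ?\<sigma> = "\<lambda>y\<in>g ` X. h (inv_into X g y)"
    have s: "?\<sigma> (g x) = h x" if "x \<in> X" for x
      using that kernel_on_eqD[OF ker, of "inv_into X g (g x)" x]
      by (simp add: f_inv_into_f inv_into_into)
    have "bij_betw ?\<sigma> (g ` X) (g ` X)"
    proof (rule bij_betw_imageI)
      show "inj_on ?\<sigma> (g ` X)"
        using s kernel_on_eqD[OF ker] by (intro inj_onI) (auto simp del: restrict_apply)
      show "?\<sigma> ` g ` X = g ` X"
        unfolding image_image using s im by (metis (no_types, lifting) image_cong)
    qed
    then have "?\<sigma> \<in> Bij (g ` X)"
      by (simp add: Bij_def)
    moreover have "h = ?s ?\<sigma>"
    proof
      show "h x = ?s ?\<sigma> x" for x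
        using s[of x] PiE_arb[OF P_in[OF h], of x] by (cases "x \<in> X") auto
    qed
    ultimately show "h \<in> ?s ` Bij (g ` X)"
      by blast
  qed
  then show ?thesis
    using card_of_ordIso ordIso_symmetric by blast
qed


text \<open>The image of \<open>bar Y a f\<close> is a transversal of its kernel: the condition for the
  \<open>\<H>\<close>-class of \<open>f\<close> to be a group.\<close>

definition transversal_image :: "('x \<Rightarrow> 'y) \<Rightarrow> bool" where
  "transversal_image f \<longleftrightarrow> (\<forall>z\<in>A. \<exists>!w. w \<in> a ` f ` X \<and> f w = f z)"

lemma image_a_subset: "f \<in> P \<Longrightarrow> a ` f ` X \<subseteq> A"
  using P_apply by auto

text \<open>The condition involves only the kernel on \<open>A\<close> and the image under
  \<open>a\<close>, and both are constant on an \<H>-hat class.\<close>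

lemma transversal_image_cong:
  assumes "f \<in> P" and "kernel_on A g = kernel_on A f" and "a ` g ` X = a ` f ` X"
  shows "transversal_image g \<longleftrightarrow> transversal_image f"
proof -
  have "(w \<in> a ` g ` X \<and> g w = g z) \<longleftrightarrow> (w \<in> a ` f ` X \<and> f w = f z)" if "z \<in> A" for w z
    using kernel_on_eqD[OF assms(2), of w z] that image_a_subset[OF assms(1)] assms(3) by blast
  then show ?thesis
    unfolding transversal_image_def by simp
qed

lemma transversal_image_unique:
  assumes "f \<in> P" "transversal_image f" "v \<in> a ` f ` X" "w \<in> a ` f ` X"
  shows "f v = f w \<longleftrightarrow> v = w"
  using assms image_a_subset[OF assms(1)] unfolding transversal_image_def by (metis subset_iff)

lemma transversal_image_ex:
  assumes "f \<in> P" "transversal_image f" "x \<in> X"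
  obtains w where "w \<in> a ` f ` X" "f w = f x"
  using assms P_obtain_A[OF assms(1,3)] unfolding transversal_image_def by metis

section \<open>Group \<H>-classes and the action on the transversal\<close>

text \<open>The identity \<open>e\<close> of the group is an idempotent with the kernel and image of
  \<open>f\<close>; idempotency makes \<open>a (e z)\<close> the only point of the transversal in
  the kernel class of \<open>z\<close>.\<close>

lemma is_group_imp_transversal_image:
  assumes f: "f \<in> P" and "is_group (green_H P (\<star>) `` {f}) (\<star>)"
  shows "transversal_image f"
proof -
  obtain e where "group \<lparr>carrier = green_H P (\<star>) `` {f}, mult = (\<star>), one = e\<rparr>"
    using assms(2) unfolding is_group_def by blast
  then interpret G: group "\<lparr>carrier = green_H P (\<star>) `` {f}, mult = (\<star>), one = e\<rparr>" .
  have ee: "e \<star> e = e" and "e \<in> green_H P (\<star>) `` {f}"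
    using G.l_one[OF G.one_closed] G.one_closed by simp_all
  then have e: "e \<in> P" "kernel_on X e = kernel_on X f" "e ` X = f ` X"
    by (auto simp: green_H_iff)
  have idem: "e (a (e x)) = e x" if "x \<in> X" for x
    using fun_cong[OF ee, of x] that by simp
  have "transversal_image e"
    unfolding transversal_image_def
  proof
    fix z assume "z \<in> A"
    then have z: "z \<in> X" using A_subset by blast
    show "\<exists>!w. w \<in> a ` e ` X \<and> e w = e z"
    proof (intro ex1I conjI)
      show "e (a (e z)) = e z"
        using z by (rule idem)
      fix w assume w: "w \<in> a ` e ` X \<and> e w = e z"
      then obtain x where x: "x \<in> X" "w = a (e x)"
        by blast
      then have "e w = e x"
        using idem by simp
      then show "w = a (e z)"
        using w x by simp
    qed (use z in blast)
  qed
  moreover have "kernel_on A e = kernel_on A f"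
    using e(2) A_subset by (rule kernel_on_mono)
  ultimately show ?thesis
    using transversal_image_cong[OF f, of e, unfolded e(3)] by blast
qed

text \<open>On a group class, \<open>act\<close> reverses products, since \<^const>\<open>sandwich_mult\<close> composes from left to right
  and \<^const>\<open>BijGroup\<close> from right to left.\<close>

definition act :: "'x set \<Rightarrow> ('x \<Rightarrow> 'y) \<Rightarrow> 'x \<Rightarrow> 'x" where
  "act N g = (\<lambda>z\<in>N. a (g z))"

text \<open>A transversal meets each kernel class once: this makes \<open>g\<close> injective on it,
  and lets \<open>g\<close> attain all its values there.\<close>

lemma act_Bij:
  assumes g: "g \<in> P" "transversal_image g"
  shows "act (a ` g ` X) g \<in> Bij (a ` g ` X)"
proof -
  let ?N = "a ` g ` X"
  have N: "?N \<subseteq> X"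
    using image_a_subset[OF g(1)] A_subset by blast
  have "inj_on (act ?N g) ?N"
  proof (rule inj_onI)
    fix v w assume *: "v \<in> ?N" "w \<in> ?N" "act ?N g v = act ?N g w"
    then have "g v = g w"
      using P_a_eq[OF g(1)] N by (simp add: act_def subset_iff)
    then show "v = w"
      using * transversal_image_unique[OF g] by blast
  qed
  moreover have "act ?N g ` ?N = ?N"
  proof (intro subset_antisym subsetI)
    fix v assume "v \<in> ?N"
    then obtain x where x: "x \<in> X" "v = a (g x)" by blast
    obtain w where "w \<in> ?N" "g w = g x"
      using transversal_image_ex[OF g x(1)] .
    then show "v \<in> act ?N g ` ?N"
      using x by (intro image_eqI[of _ _ w]) (simp_all add: act_def)
  qed (use N in \<open>auto simp: act_def\<close>)
  ultimately show ?thesis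
    by (auto simp: Bij_def bij_betw_def act_def)
qed

lemma act_star:
  assumes "N \<subseteq> X" and "\<And>z. z \<in> N \<Longrightarrow> a (g z) \<in> N"
  shows "act N (g \<star> h) = compose N (act N h) (act N g)"
  using assms by (auto simp: act_def compose_def fun_eq_iff)

abbreviation Hhat where
  "Hhat f \<equiv> {g \<in> P. kernel_on A g = kernel_on A f \<and> a ` g ` X = a ` f ` X}"

text \<open>All members of the hat class share one transversal, on which \<open>h\<close> is
  injective and attains all its values. Hence a product keeps the kernel of its left factor and the
  image of its right factor, the source of the rectangular band.\<close>

lemma star_Hhat:
  assumes f: "f \<in> P" "transversal_image f" and g: "g \<in> Hhat f" and h: "h \<in> Hhat f"
  shows "kernel_on X (g \<star> h) = kernel_on X g" "(g \<star> h) ` X = h ` X" "g \<star> h \<in> Hhat f"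
proof -
  have h': "h \<in> P" "transversal_image h"
    using f h transversal_image_cong[of f h] by auto
  have gP: "g \<in> P" and N: "a ` g ` X = a ` h ` X"
    using g h by auto
  have "h (a (g x)) = h (a (g y)) \<longleftrightarrow> g x = g y" if "x \<in> X" "y \<in> X" for x y
    using transversal_image_unique[OF h', of "a (g x)" "a (g y)"] P_a_eq[OF gP] that N by blast
  then show ker: "kernel_on X (g \<star> h) = kernel_on X g"
    by (simp add: kernel_on_eq_iff)
  show im: "(g \<star> h) ` X = h ` X"
  proof (intro subset_antisym subsetI)
    fix y assume "y \<in> h ` X"
    then obtain x where x: "x \<in> X" "y = h x" by blast
    obtain w where w: "w \<in> a ` h ` X" "h w = h x"
      using transversal_image_ex[OF h' x(1)] .
    then obtain v where "v \<in> X" "w = a (g v)"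
      using N by blast
    then show "y \<in> (g \<star> h) ` X"
      using w x by (intro image_eqI[of _ _ v]) simp_all
  qed (use P_apply[OF gP] a_in in auto)
  show "g \<star> h \<in> Hhat f"
    using star_P[OF gP h'(1)] kernel_on_mono[OF ker A_subset] g h im by simp
qed

lemma act_Hhat:
  assumes f: "f \<in> P" "transversal_image f" and g: "g \<in> Hhat f"
  shows "act (a ` f ` X) g \<in> Bij (a ` f ` X)"
  using act_Bij[of g] g f transversal_image_cong[of f g] by auto

lemma act_star_Hhat:
  assumes f: "f \<in> P" "transversal_image f" and g: "g \<in> Hhat f"
  shows "act (a ` f ` X) (g \<star> h) = compose (a ` f ` X) (act (a ` f ` X) h) (act (a ` f ` X) g)"
proof (rule act_star)
  show "a ` f ` X \<subseteq> X"
    using image_a_subset[OF f(1)] A_subset by blast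
  show "a (g z) \<in> a ` f ` X" if "z \<in> a ` f ` X" for z
    using Bij_imp_funcset[OF act_Hhat[OF assms]] that by (auto simp: act_def Pi_iff)
qed

lemma green_H_subset_Hhat: "g \<in> Hhat f \<Longrightarrow> green_H P (\<star>) `` {g} \<subseteq> Hhat f"
  using kernel_on_mono[of X g _ A] A_subset by (force simp: green_H_iff)

text \<open>Injectivity: each kernel class contains a point of the transversal, where the action
  gives \<open>a (h w)\<close> and so \<open>h w\<close>, as \<open>a\<close> is injective on the
  image. Surjectivity: the values of \<open>g\<close> are relabelled.\<close>

lemma act_bij_betw_green_H:
  assumes f: "f \<in> P" "transversal_image f" and g: "g \<in> Hhat f"
  shows "bij_betw (act (a ` f ` X)) (green_H P (\<star>) `` {g}) (Bij (a ` f ` X))"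
proof -
  let ?N = "a ` f ` X"
  let ?q = "act ?N g"
  have gP: "g \<in> P" and gt: "transversal_image g" and N: "a ` g ` X = ?N"
    using g f transversal_image_cong[of f g] by auto
  have NX: "?N \<subseteq> X"
    using image_a_subset[OF f(1)] A_subset by blast
  have "inj_on (act ?N) (green_H P (\<star>) `` {g})"
  proof (rule inj_onI)
    fix h k assume hk: "h \<in> green_H P (\<star>) `` {g}" "k \<in> green_H P (\<star>) `` {g}"
      and eq: "act ?N h = act ?N k"
    then have hP: "h \<in> P" and kP: "k \<in> P" and hker: "kernel_on X g = kernel_on X h"
      and kker: "kernel_on X g = kernel_on X k" and im: "h ` X = k ` X"
      by (auto simp: green_H_iff)
    show "h = k"
    proof (rule P_ext[OF hP kP])
      fix x assume x: "x \<in> X"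
      obtain w where w: "w \<in> ?N" "g w = g x"
        using transversal_image_ex[OF gP gt x] N by metis
      then have wX: "w \<in> X"
        using NX by blast
      then have "h w = h x" "k w = k x"
        using kernel_on_eqD[OF hker] kernel_on_eqD[OF kker] w x by blast+
      moreover have "a (h w) = a (k w)"
        using fun_cong[OF eq, of w] w by (simp add: act_def)
      then have "h w = k w"
        using P_inj[OF hP] im wX by (auto dest: inj_onD)
      ultimately show "h x = k x"
        by simp
    qed
  qed
  moreover have "\<exists>h \<in> green_H P (\<star>) `` {g}. act ?N h = p" if p: "p \<in> Bij ?N" for p
  proof -
    have q: "bij_betw ?q ?N ?N"
      using act_Hhat[OF assms] by (simp add: Bij_def)
    have aN: "bij_betw a (g ` X) ?N"
      using inj_on_imp_bij_betw[OF P_inj[OF gP]] N by simp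
    \<comment> \<open>At a point \<open>z\<close> of the transversal, \<open>a (g z)\<close> is
      \<open>?q z\<close>. Undoing \<open>?q\<close> recovers \<open>z\<close>, and the rest lifts
      \<open>p z\<close> back through \<open>a\<close> to the image of \<open>g\<close>.\<close>
    let ?\<sigma> = "inv_into (g ` X) a \<circ> (p \<circ> (inv_into ?N ?q \<circ> a))"
    have \<sigma>: "bij_betw ?\<sigma> (g ` X) (g ` X)"
      using p by (intro bij_betw_trans[OF _ bij_betw_inv_into[OF aN]]
        bij_betw_trans[OF bij_betw_trans[OF aN bij_betw_inv_into[OF q]]]) (simp add: Bij_def)
    let ?h = "\<lambda>x\<in>X. ?\<sigma> (g x)"
    have "?h \<in> green_H P (\<star>) `` {g}"
      using relabel_P[OF gP \<sigma>] P_apply[OF gP] P_inj[OF gP] gP by (auto simp: green_H_iff)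
    moreover have "act ?N ?h z = p z" for z
    proof (cases "z \<in> ?N")
      case True
      then have "inv_into ?N ?q (a (g z)) = z"
        using bij_betw_inv_into_left[OF q True] by (simp add: act_def)
      moreover have "a (inv_into (g ` X) a (p z)) = p z"
        using Bij_imp_funcset[OF p] True bij_betw_inv_into_right[OF aN] by blast
      ultimately show ?thesis
        using True NX by (auto simp: act_def)
    next
      case False
      then show ?thesis
        using Bij_imp_extensional[OF p] by (simp add: act_def extensional_def)
    qed
    ultimately show ?thesis
      by blast
  qed
  ultimately show ?thesis
    using act_Hhat[OF f] green_H_subset_Hhat[OF g] by (auto simp: bij_betw_def)
qed

text \<open>The action is an anti-isomorphism onto the permutations of the transversal, and the
  inverse of \<open>a\<close> carries these to permutations of the image of
  \<open>f\<close>.\<close>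

lemma transversal_image_imp_group_iso:
  assumes f: "f \<in> P" "transversal_image f" and g: "g \<in> Hhat f"
  shows "is_group_iso (green_H P (\<star>) `` {g}) (\<star>) (BijGroup (f ` X))"
proof -
  let ?N = "a ` f ` X"
  have Hhat: "h \<in> Hhat f" if "h \<in> green_H P (\<star>) `` {g}" for h
    using that green_H_subset_Hhat[OF g] by blast
  have "is_group_iso (green_H P (\<star>) `` {g}) (\<star>) (BijGroup ?N)"
  proof (rule is_group_iso_anti[where h = "act ?N"])
    show "bij_betw (act ?N) (green_H P (\<star>) `` {g}) (carrier (BijGroup ?N))"
      using act_bij_betw_green_H[OF assms] by simp
    fix h k assume hk: "h \<in> green_H P (\<star>) `` {g}" "k \<in> green_H P (\<star>) `` {g}"
    show "act ?N (h \<star> k) = act ?N k \<otimes>\<^bsub>BijGroup ?N\<^esub> act ?N h"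
      using act_star_Hhat[OF f Hhat[OF hk(1)], of k] act_Hhat[OF f Hhat[OF hk(1)]]
        act_Hhat[OF f Hhat[OF hk(2)]] by simp
    show "h \<star> k \<in> green_H P (\<star>) `` {g}"
      using star_Hhat[OF f Hhat[OF hk(1)] Hhat[OF hk(2)]] hk by (auto simp: green_H_iff)
  qed (rule group_BijGroup)
  moreover have "bij_betw (inv_into (f ` X) a) ?N (f ` X)"
    using inj_on_imp_bij_betw[OF P_inj[OF f(1)]] by (rule bij_betw_inv_into)
  then have "BijGroup ?N \<cong> BijGroup (f ` X)"
    using BijGroup_iso is_isoI by blast
  ultimately show ?thesis
    by (rule is_group_iso_trans)
qed

end

lemma is_group_transformations_iff:
  assumes p: "p \<in> S \<rightarrow>\<^sub>E S"
  shows "is_group (green_H (S \<rightarrow>\<^sub>E S) (trans_mult S) `` {p}) (trans_mult S) \<longleftrightarrow>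
    (\<forall>z\<in>S. \<exists>!w. w \<in> p ` S \<and> p w = p z)"
proof -
  interpret T: sandwich S S id
    by (rule sandwich_id)
  have P: "p \<in> reg_sandwich S S id"
    using p by (simp add: reg_sandwich_id)
  have "is_group (green_H (reg_sandwich S S id) (sandwich_mult S id) `` {p}) (sandwich_mult S id)
      \<longleftrightarrow> T.transversal_image p"
    using T.is_group_imp_transversal_image[OF P] T.transversal_image_imp_group_iso[OF P]
      is_group_iso_imp_is_group P by blast
  then show ?thesis
    by (simp add: T.transversal_image_def reg_sandwich_id trans_mult_eq_sandwich_mult)
qed

text \<open>Passing to \<open>bar\<close> preserves the kernel on \<open>A\<close>, and the image of
  \<open>bar Y a f\<close> is the candidate transversal itself; so the criterion for
  \<open>f\<close> is the one for its image in the transformation semigroup of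
  \<open>A\<close>.\<close>

lemma (in sandwich) transversal_image_iff_bar:
  assumes f: "f \<in> P"
  shows "transversal_image f \<longleftrightarrow>
    is_group (green_H (A \<rightarrow>\<^sub>E A) (trans_mult A) `` {bar Y a f}) (trans_mult A)"
proof -
  have "bar Y a f w = bar Y a f z \<longleftrightarrow> f w = f z" if "z \<in> A" "w \<in> a ` f ` X" for w z
    using bar_eq_iff[OF f _ that(1)] that(2) image_a_subset[OF f] by blast
  then show ?thesis
    unfolding is_group_transformations_iff[OF bar_in[OF f]] transversal_image_def image_bar[OF f]
    by (simp cong: conj_cong)
qed


section \<open>Invariants of the classes\<close>

text \<open>Inversion followed by conjugation. Its reversal of products will cancel the reversal
  made by \<open>act\<close>.\<close>

lemma BijGroup_anti_iso:
  assumes "bij_betw b N M"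
  obtains d where "bij_betw d (Bij N) (Bij M)"
    and "\<And>p q. p \<in> Bij N \<Longrightarrow> q \<in> Bij N \<Longrightarrow> d (compose N p q) = d q \<otimes>\<^bsub>BijGroup M\<^esub> d p"
proof -
  interpret group "BijGroup N"
    by (rule group_BijGroup)
  obtain c where c: "c \<in> iso (BijGroup N) (BijGroup M)"
    using BijGroup_iso[OF assms] by blast
  let ?inv = "\<lambda>p. inv\<^bsub>BijGroup N\<^esub> p"
  have inv: "?inv p \<in> Bij N" if "p \<in> Bij N" for p
    using inv_closed[of p] that by simp
  have "bij_betw ?inv (Bij N) (Bij N)"
    using inv inv_inv by (intro bij_betw_byWitness[where f' = ?inv]) auto
  then have "bij_betw (c \<circ> ?inv) (Bij N) (Bij M)"
    using c by (intro bij_betw_trans) (auto simp: iso_def)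
  moreover have "(c \<circ> ?inv) (compose N p q) = (c \<circ> ?inv) q \<otimes>\<^bsub>BijGroup M\<^esub> (c \<circ> ?inv) p"
    if "p \<in> Bij N" "q \<in> Bij N" for p q
    using inv_mult_group[of p q] that hom_mult[of c "BijGroup N" "BijGroup M"] c inv
    by (simp add: iso_def)
  ultimately show thesis
    by (rule that)
qed


context sandwich
begin

section \<open>Invariants for kernels: offsets outside \<open>A\<close>\<close>

abbreviation Rhat where "Rhat f \<equiv> {g \<in> P. kernel_on A g = kernel_on A f}"
abbreviation Lhat where "Lhat f \<equiv> {g \<in> P. a ` g ` X = a ` f ` X}"
abbreviation Dclass where "Dclass f \<equiv> {g \<in> P. |g ` X| =o |f ` X|}"

text \<open>Each \<open>\<R>\<close>-class in \<open>Rhat f\<close> has exactly one member that agrees with \<open>f\<close> on \<open>A\<close>;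
  \<open>offset f g\<close> is the restriction of that member to \<open>X - A\<close>.\<close>

definition offset :: "('x \<Rightarrow> 'y) \<Rightarrow> ('x \<Rightarrow> 'y) \<Rightarrow> 'x \<Rightarrow> 'y" where
  "offset f g = (\<lambda>x\<in>X - A. f (inv_into A g (g x)))"

lemma inv_into_A:
  assumes "g \<in> P" "x \<in> X"
  shows "inv_into A g (g x) \<in> A" "g (inv_into A g (g x)) = g x"
proof -
  have "g x \<in> g ` A"
    using P_image assms by blast
  then show "inv_into A g (g x) \<in> A" "g (inv_into A g (g x)) = g x"
    by (rule inv_into_into, rule f_inv_into_f)
qed

text \<open>The map \<open>?r g\<close> is a normal form of the kernel: it agrees with
  \<open>f\<close> on \<open>A\<close> and has the same kernel as \<open>g\<close> on
  \<open>X\<close>. Only its values outside \<open>A\<close> vary, and these are the offset.\<close>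

lemma offset_eq_iff:
  assumes g: "g \<in> Rhat f" and h: "h \<in> Rhat f"
  shows "offset f g = offset f h \<longleftrightarrow> kernel_on X g = kernel_on X h"
proof -
  let ?r = "\<lambda>g x. f (inv_into A g (g x))"
  have ker: "f z = f w \<longleftrightarrow> g z = g w" if "g \<in> Rhat f" "z \<in> A" "w \<in> A" for g z w
    using kernel_on_eqD[of A g f z w] that by simp
  have r_A: "?r g x = f x" if "g \<in> Rhat f" "x \<in> A" for g x
    using ker[OF that(1) _ that(2)] inv_into_A[of g x] that A_subset by blast
  have r_ker: "?r g x = ?r g y \<longleftrightarrow> g x = g y" if "g \<in> Rhat f" "x \<in> X" "y \<in> X" for g x y
    using ker[OF that(1)] inv_into_A[of g] that by simp
  show ?thesis
  proof
    assume eq: "offset f g = offset f h"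
    have r: "?r g x = ?r h x" if "x \<in> X" for x
    proof (cases "x \<in> A")
      case True
      then show ?thesis
        using r_A g h by simp
    next
      case False
      then show ?thesis
        using fun_cong[OF eq, of x] that by (simp add: offset_def)
    qed
    have "g x = g y \<longleftrightarrow> h x = h y" if "x \<in> X" "y \<in> X" for x y
      using r_ker[OF g that] r_ker[OF h that] r[OF that(1)] r[OF that(2)] by simp
    then show "kernel_on X g = kernel_on X h"
      by (simp add: kernel_on_eq_iff)
  next
    assume eq: "kernel_on X g = kernel_on X h"
    have "?r g x = ?r h x" if x: "x \<in> X" for x
    proof -
      let ?z = "inv_into A g (g x)" and ?w = "inv_into A h (h x)"
      have z: "?z \<in> A" "g ?z = g x" and w: "?w \<in> A" "h ?w = h x"
        using inv_into_A g h x by auto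
      then have "h ?z = h x"
        using kernel_on_eqD[OF eq, of ?z x] x A_subset by blast
      then show ?thesis
        using ker[OF h z(1) w(1)] w by simp
    qed
    then show "offset f g = offset f h"
      by (auto simp: offset_def fun_eq_iff)
  qed
qed

lemma P_I_image:
  assumes f: "f \<in> P" and im: "h ` X = f ` X" "h ` A = f ` X" and "h \<in> extensional X"
  shows "h \<in> P"
proof (rule P_I)
  have "h ` X \<subseteq> Y"
    using im P_apply[OF f] by auto
  then show "h \<in> X \<rightarrow>\<^sub>E Y"
    using \<open>h \<in> extensional X\<close> by (auto simp: PiE_def)
  show "inj_on a (h ` X)" "h ` X \<subseteq> h ` A"
    using im P_inj[OF f] by simp_all
qed

text \<open>Gluing \<open>f\<close> on \<open>A\<close> with arbitrary values from its image outside
  \<open>A\<close> adds no new values. The result is therefore regular, and its offset is the glued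
  part. \<open>Func\<close> is the set that \<open>cexp\<close> counts.\<close>

lemma offset_image:
  assumes f: "f \<in> P"
  shows "offset f ` Rhat f = Func (X - A) (f ` X)"
proof (intro subset_antisym subsetI)
  fix u assume "u \<in> offset f ` Rhat f"
  then obtain g where g: "g \<in> P" "u = offset f g"
    by blast
  then show "u \<in> Func (X - A) (f ` X)"
    using inv_into_A(1)[OF g(1)] A_subset by (auto simp: Func_def offset_def)
next
  fix u assume u: "u \<in> Func (X - A) (f ` X)"
  define g where "g = (\<lambda>x\<in>X. if x \<in> A then f x else u x)"
  have gA: "g z = f z" if "z \<in> A" for z
    using that A_subset by (auto simp: g_def)
  then have img: "g ` A = f ` X"
    using P_image[OF f] by (metis image_cong)
  have "g x \<in> f ` X" if "x \<in> X" for x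
    using that u by (auto simp: g_def Func_def)
  then have im: "g ` X = f ` X"
    using img A_subset by blast
  have gP: "g \<in> P"
    using f im img by (rule P_I_image) (simp add: g_def)
  have "kernel_on A g = kernel_on A f"
    by (simp add: kernel_on_eq_iff gA)
  moreover have "offset f g = u"
  proof
    fix x
    show "offset f g x = u x"
    proof (cases "x \<in> X - A")
      case True
      then have "f (inv_into A g (g x)) = g x"
        using inv_into_A[OF gP, of x] gA by simp
      then show ?thesis
        using True by (simp add: offset_def g_def)
    next
      case False
      then show ?thesis
        using u by (auto simp: offset_def Func_def)
    qed
  qed
  ultimately show "u \<in> offset f ` Rhat f"
    using gP by blast
qed

lemma Rhat_closed: "g \<in> Rhat f \<Longrightarrow> h \<in> P \<Longrightarrow> kernel_on X g = kernel_on X h \<Longrightarrow> h \<in> Rhat f"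
  using kernel_on_mono[of X g h A] A_subset by simp

lemma union_of_green_R_Rhat:
  assumes f: "f \<in> P"
  shows "union_of_classes P (green_R P (\<star>)) ( |f ` X| ^c |X - A| ) (Rhat f)"
proof (rule union_of_classes_invariant[where F = "offset f"])
  show "green_R P (\<star>) `` Rhat f \<subseteq> Rhat f"
  proof clarify
    fix g h assume g: "g \<in> P" "kernel_on A g = kernel_on A f" and "(g, h) \<in> green_R P (\<star>)"
    then show "h \<in> P \<and> kernel_on A h = kernel_on A f"
      using Rhat_closed[of g f h] by (simp add: green_R_iff)
  qed
  show "(g, h) \<in> green_R P (\<star>) \<longleftrightarrow> offset f g = offset f h" if "g \<in> Rhat f" "h \<in> Rhat f" for g h
    using offset_eq_iff[OF that] that by (simp add: green_R_iff)
  show "|offset f ` Rhat f| =o |f ` X| ^c |X - A|"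
    by (simp add: offset_image[OF f] cexp_def Field_card_of card_of_refl)
qed (auto simp: equiv_green_R)

text \<open>An invariant of the kernel and an invariant of the image can be prescribed
  independently: for equal ranks, \<open>P_meet\<close> yields a map with the kernel of
  \<open>g\<close> and the image of \<open>h\<close>. Both counts of \<H>-classes rest on
  this.\<close>

lemma image_pair_invariant:
  assumes "C1 \<subseteq> P" and "C2 \<subseteq> P"
    and closed1: "\<And>g h. g \<in> C1 \<Longrightarrow> h \<in> P \<Longrightarrow> kernel_on X h = kernel_on X g \<Longrightarrow> h \<in> C1"
    and closed2: "\<And>g h. g \<in> C2 \<Longrightarrow> h \<in> P \<Longrightarrow> h ` X = g ` X \<Longrightarrow> h \<in> C2"
    and rank: "\<And>g h. g \<in> C1 \<Longrightarrow> h \<in> C2 \<Longrightarrow> |g ` X| =o |h ` X|"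
    and F: "\<And>g h. g \<in> C1 \<Longrightarrow> h \<in> C1 \<Longrightarrow> kernel_on X g = kernel_on X h \<Longrightarrow> F g = F h"
    and G: "\<And>g h. g \<in> C2 \<Longrightarrow> h \<in> C2 \<Longrightarrow> g ` X = h ` X \<Longrightarrow> G g = G h"
  shows "(\<lambda>g. (F g, G g)) ` (C1 \<inter> C2) = F ` C1 \<times> G ` C2"
proof (intro subset_antisym subsetI)
  fix p assume "p \<in> F ` C1 \<times> G ` C2"
  then obtain g h where g: "g \<in> C1" and h: "h \<in> C2" and p: "p = (F g, G h)"
    by blast
  obtain k where "k \<in> P" "kernel_on X k = kernel_on X g" "k ` X = h ` X"
    using P_meet rank[OF g h] g h assms(1,2) by blast
  then have "k \<in> C1 \<inter> C2" "F k = F g" "G k = G h"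
    using closed1[OF g, of k] closed2[OF h, of k] F[OF _ g, of k] G[OF _ h, of k] by blast+
  then show "p \<in> (\<lambda>g. (F g, G g)) ` (C1 \<inter> C2)"
    using p by (intro image_eqI[of _ _ k]) simp_all
qed auto

lemma Dclass_closed:
  assumes "g \<in> Dclass f" and "h \<in> P" and "|g ` X| =o |h ` X|"
  shows "h \<in> Dclass f"
  using assms ordIso_transitive[OF ordIso_symmetric[OF assms(3)], of "|f ` X|"] by simp

text \<open>Realises every equivalence on \<open>A\<close> with the right number of classes:
  \<open>b\<close> names the classes by the values of \<open>f\<close>, and a retraction onto
  \<open>A\<close> extends the map to \<open>X\<close>.\<close>

lemma ex_given_kernel:
  assumes f: "f \<in> P" and E: "equiv A E" and card: "|A // E| =o |f ` X|"
  obtains h where "h \<in> P" "kernel_on A h = E" "h ` X = f ` X"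
proof -
  obtain b where b: "bij_betw b (A // E) (f ` X)"
    using card card_of_ordIso by blast
  \<comment> \<open>All points outside \<open>A\<close> go to one fixed point of \<open>A\<close>,
    which exists as soon as \<open>X\<close> has a point.\<close>
  define r where "r = (\<lambda>x. if x \<in> A then x else SOME z. z \<in> A)"
  have r: "r x \<in> A" if "x \<in> X" for x
  proof -
    have "\<exists>z. z \<in> A"
      using P_obtain_A[OF f that] by blast
    then show ?thesis
      by (auto simp: r_def intro: someI_ex)
  qed
  define h where "h = (\<lambda>x\<in>X. b (E `` {r x}))"
  have hA: "h z = b (E `` {z})" if "z \<in> A" for z
    using that A_subset by (auto simp: h_def r_def)
  have "h ` A = b ` (\<lambda>z. E `` {z}) ` A"
    unfolding image_image by (intro image_cong) (simp_all add: hA)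
  also have "(\<lambda>z. E `` {z}) ` A = A // E"
    by (auto simp: quotient_def)
  finally have img: "h ` A = f ` X"
    using b by (simp add: bij_betw_def)
  have "h x \<in> h ` A" if "x \<in> X" for x
    using hA[OF r[OF that]] r[OF that] that by (intro image_eqI[of _ _ "r x"]) (simp_all add: h_def)
  then have im: "h ` X = f ` X"
    using img A_subset by blast
  have "h \<in> P"
    using f im img by (rule P_I_image) (simp add: h_def)
  moreover have "h z = h w \<longleftrightarrow> (z, w) \<in> E" if "z \<in> A" "w \<in> A" for z w
  proof -
    have "E `` {z} \<in> A // E" "E `` {w} \<in> A // E"
      using that by (auto simp: quotient_def)
    then have "h z = h w \<longleftrightarrow> E `` {z} = E `` {w}"
      using b that by (auto simp: hA bij_betw_def inj_on_def)
    then show ?thesis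
      using eq_equiv_class_iff[OF E that] by simp
  qed
  then have "kernel_on A h = E"
    using equiv_type[OF E] by (auto simp: kernel_on_def)
  ultimately show thesis
    using im that by blast
qed

text \<open>Offsets are taken relative to a map with the kernel of \<open>g\<close> on \<open>A\<close> but with the image of \<open>f\<close>, so that
  they range over the same set for all these kernels.\<close>

definition representative :: "('x \<Rightarrow> 'y) \<Rightarrow> 'x rel \<Rightarrow> 'x \<Rightarrow> 'y" where
  "representative f E = (SOME h. h \<in> P \<and> kernel_on A h = E \<and> h ` X = f ` X)"

definition kernel_invariant :: "('x \<Rightarrow> 'y) \<Rightarrow> ('x \<Rightarrow> 'y) \<Rightarrow> ('x \<Rightarrow> 'y) \<times> 'x rel" where
  "kernel_invariant f g = (offset (representative f (kernel_on A g)) g, kernel_on A g)"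

lemma representative:
  assumes "f \<in> P" "equiv A E" "|A // E| =o |f ` X|"
  shows "representative f E \<in> P" "kernel_on A (representative f E) = E"
    "representative f E ` X = f ` X"
proof -
  have "\<exists>h. h \<in> P \<and> kernel_on A h = E \<and> h ` X = f ` X"
    using ex_given_kernel[OF assms] by blast
  then have "representative f E \<in> P \<and> kernel_on A (representative f E) = E \<and>
      representative f E ` X = f ` X"
    unfolding representative_def by (rule someI_ex)
  then show "representative f E \<in> P" "kernel_on A (representative f E) = E"
    "representative f E ` X = f ` X"
    by blast+
qed

lemma card_of_quotient_Dclass:
  assumes "g \<in> Dclass f"
  shows "|A // kernel_on A g| =o |f ` X|"
proof -
  have "|A // kernel_on A g| =o |g ` X|"
    using card_of_quotient_kernel_on[of A g] P_image[of g] assms by simp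
  then show ?thesis
    using assms ordIso_transitive by blast
qed

lemma kernel_invariant_eq_iff:
  assumes f: "f \<in> P" and g: "g \<in> Dclass f" and h: "h \<in> Dclass f"
  shows "kernel_invariant f g = kernel_invariant f h \<longleftrightarrow> kernel_on X g = kernel_on X h"
proof (cases "kernel_on A g = kernel_on A h")
  case True
  let ?k = "representative f (kernel_on A g)"
  have "kernel_on A ?k = kernel_on A g"
    using representative(2)[OF f equiv_kernel_on card_of_quotient_Dclass[OF g]] .
  then have "offset ?k g = offset ?k h \<longleftrightarrow> kernel_on X g = kernel_on X h"
    using True g h by (intro offset_eq_iff) auto
  then show ?thesis
    using True by (simp add: kernel_invariant_def)
next
  case False
  then show ?thesis
    using kernel_on_mono[OF _ A_subset, of g h] by (auto simp: kernel_invariant_def)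
qed

text \<open>For a fixed kernel \<open>E\<close> on \<open>A\<close>, the offsets relative to the
  representative fill one and the same function space, since every representative has the image of
  \<open>f\<close>. The image is thus a full product.\<close>

lemma kernel_invariant_image:
  assumes f: "f \<in> P"
  shows "kernel_invariant f ` Dclass f =
    Func (X - A) (f ` X) \<times> {E. equiv A E \<and> |A // E| =o |f ` X|}"
proof (intro subset_antisym subsetI)
  fix p assume "p \<in> kernel_invariant f ` Dclass f"
  then obtain g where g: "g \<in> Dclass f" and p: "p = kernel_invariant f g"
    by blast
  let ?k = "representative f (kernel_on A g)"
  note k = representative[OF f equiv_kernel_on card_of_quotient_Dclass[OF g]]
  have "offset ?k g \<in> offset ?k ` Rhat ?k"
    using g k(2) by (intro imageI) simp
  then show "p \<in> Func (X - A) (f ` X) \<times> {E. equiv A E \<and> |A // E| =o |f ` X|}"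
    using p equiv_kernel_on card_of_quotient_Dclass[OF g]
    by (simp add: offset_image[OF k(1)] k(3) kernel_invariant_def)
next
  fix p assume "p \<in> Func (X - A) (f ` X) \<times> {E. equiv A E \<and> |A // E| =o |f ` X|}"
  then obtain u E where p: "p = (u, E)" and u: "u \<in> Func (X - A) (f ` X)"
    and E: "equiv A E" "|A // E| =o |f ` X|"
    by blast
  let ?k = "representative f E"
  note k = representative[OF f E]
  have "u \<in> offset ?k ` Rhat ?k"
    using u k(3) by (simp add: offset_image[OF k(1)])
  then obtain g where g: "g \<in> P" "kernel_on A g = kernel_on A ?k" "u = offset ?k g"
    by blast
  have "|g ` X| =o |f ` X|"
    using card_of_image_Rhat[OF k(1) g(1,2)] k(3) by simp
  moreover have "p = kernel_invariant f g"
    using p g k(2) by (simp add: kernel_invariant_def)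
  ultimately show "p \<in> kernel_invariant f ` Dclass f"
    using g(1) by blast
qed

end


section \<open>Invariants for images: index sets and choices in fibres\<close>

locale sandwich_indexed = sandwich X Y a
  for X :: "'x set" and Y :: "'y set" and a :: "'y \<Rightarrow> 'x" +
  fixes I :: "'i set" and pt :: "'i \<Rightarrow> 'x"
  assumes pt: "bij_betw pt I (a ` Y)"
begin

definition fiber :: "'i \<Rightarrow> 'y set" where
  "fiber i = {y \<in> Y. a y = pt i}"

text \<open>For the map \<open>f\<close> of the theorem this is \<open>J\<close>.\<close>

definition idx :: "('x \<Rightarrow> 'y) \<Rightarrow> 'i set" where
  "idx g = {i \<in> I. pt i \<in> a ` g ` X}"

text \<open>The choice of one value in each fibre that the image meets, extensional so as to be an
  element of the product of the fibres. For \<open>f\<close> it is the family of the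
  \<open>f_j\<close>.\<close>

definition sel :: "('x \<Rightarrow> 'y) \<Rightarrow> 'i \<Rightarrow> 'y" where
  "sel g = (\<lambda>i\<in>idx g. inv_into (g ` X) a (pt i))"

lemma pt_eq: "i \<in> I \<Longrightarrow> j \<in> I \<Longrightarrow> pt i = pt j \<longleftrightarrow> i = j"
  using pt by (auto simp: bij_betw_def inj_on_def)

lemma sel:
  assumes "i \<in> idx g"
  shows "sel g i \<in> g ` X" "a (sel g i) = pt i"
  using assms by (auto simp: idx_def sel_def intro!: inv_into_into f_inv_into_f)

lemma sel_in: "g \<in> P \<Longrightarrow> sel g \<in> (\<Pi>\<^sub>E i\<in>idx g. fiber i)"
proof (rule PiE_I)
  assume g: "g \<in> P"
  show "sel g i \<in> fiber i" if "i \<in> idx g" for i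
    using sel[OF that] P_apply[OF g] by (auto simp: fiber_def)
qed (simp add: sel_def)

lemma sel_bij_betw:
  assumes g: "g \<in> P"
  shows "bij_betw (sel g) (idx g) (g ` X)"
proof (rule bij_betw_imageI)
  show "inj_on (sel g) (idx g)"
    using sel(2)[of _ g] pt_eq by (intro inj_onI) (metis (no_types, lifting) idx_def mem_Collect_eq)
  show "sel g ` idx g = g ` X"
  proof (intro subset_antisym subsetI)
    fix y assume y: "y \<in> g ` X"
    then have "a y \<in> a ` Y"
      using P_apply[OF g] by blast
    then obtain i where i: "i \<in> I" "pt i = a y"
      using pt by (metis bij_betw_def imageE)
    then have idx: "i \<in> idx g"
      using y by (auto simp: idx_def)
    then have "sel g i = y"
      using sel[OF idx] i y P_inj[OF g] by (auto dest: inj_onD)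
    then show "y \<in> sel g ` idx g"
      using idx by blast
  qed (use sel in blast)
qed

lemma idx_sel_eq_iff:
  assumes "g \<in> P" "h \<in> P"
  shows "(idx g, sel g) = (idx h, sel h) \<longleftrightarrow> g ` X = h ` X"
proof
  assume "(idx g, sel g) = (idx h, sel h)"
  then show "g ` X = h ` X"
    using sel_bij_betw[OF assms(1)] sel_bij_betw[OF assms(2)] by (simp add: bij_betw_def)
qed (simp add: idx_def sel_def)

lemma idx_Lhat: "g \<in> Lhat f \<Longrightarrow> idx g = idx f"
  by (simp add: idx_def)

lemma idx_subset: "idx g \<subseteq> I"
  by (auto simp: idx_def)

lemma card_of_idx: "g \<in> P \<Longrightarrow> |idx g| =o |g ` X|"
  using sel_bij_betw card_of_ordIso by blast

text \<open>The values of \<open>f\<close> are renamed through \<open>K\<close> to the values of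
  \<open>t\<close>; \<open>a\<close> is injective on these because
  \<open>a (t k) = pt k\<close>.\<close>

lemma ex_given_sel:
  assumes f: "f \<in> P" and K: "K \<subseteq> I" "|K| =o |f ` X|" and t: "t \<in> (\<Pi>\<^sub>E i\<in>K. fiber i)"
  obtains g where "g \<in> P" "|g ` X| =o |f ` X|" "a ` g ` X = pt ` K" "idx g = K" "sel g = t"
proof -
  have at: "a (t k) = pt k" "t k \<in> Y" if "k \<in> K" for k
    using t that by (auto simp: fiber_def)
  have t_eq: "t k = t l \<longleftrightarrow> k = l" "pt k = pt l \<longleftrightarrow> k = l" if "k \<in> K" "l \<in> K" for k l
    using that at[of k] at[of l] K(1) pt_eq by (metis subsetD)+
  obtain b where b: "bij_betw b (f ` X) K"
    using K(2) ordIso_symmetric card_of_ordIso by blast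
  have "bij_betw t K (t ` K)"
    using t_eq by (auto simp: bij_betw_def inj_on_def)
  then have \<sigma>: "bij_betw (t \<circ> b) (f ` X) (t ` K)"
    using b bij_betw_trans by blast
  have "inj_on a (t ` K)"
    using at t_eq by (auto simp: inj_on_def)
  moreover have "t ` K \<subseteq> Y"
    using at by blast
  ultimately obtain g where g: "g \<in> P" "kernel_on X g = kernel_on X f" "g ` X = t ` K"
    using relabel_P[OF f \<sigma>] by metis
  have agX: "a ` g ` X = pt ` K"
    unfolding g(3) image_image by (intro image_cong) (simp_all add: at)
  have idx: "idx g = K"
    using K(1) pt_eq by (auto simp: idx_def agX)
  have "sel g k = t k" for k
  proof (cases "k \<in> K")
    case True
    then obtain l where "l \<in> K" "sel g k = t l"
      using sel(1)[of k g] idx g(3) by auto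
    then show ?thesis
      using sel(2)[of k g] idx True at t_eq by metis
  next
    case False
    then show ?thesis
      using t idx by (auto simp: sel_def)
  qed
  then have "sel g = t"
    by blast
  then show thesis
    using g agX idx card_of_image_kernel_on[OF g(2)] that by blast
qed

lemma pt_idx:
  assumes "f \<in> P"
  shows "pt ` idx f = a ` f ` X"
proof -
  have *: "a ` f ` X \<subseteq> pt ` I"
    using image_a_subset[OF assms] pt by (simp add: bij_betw_def)
  show ?thesis
  proof (intro subset_antisym subsetI)
    fix v assume v: "v \<in> a ` f ` X"
    then obtain i where "i \<in> I" "v = pt i"
      using * by blast
    then show "v \<in> pt ` idx f"
      using v by (simp add: idx_def)
  qed (use idx_def in auto)
qed

lemma sel_image_Lhat:
  assumes f: "f \<in> P"
  shows "sel ` Lhat f = (\<Pi>\<^sub>E i\<in>idx f. fiber i)"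
proof (intro subset_antisym subsetI)
  fix t assume "t \<in> sel ` Lhat f"
  then show "t \<in> (\<Pi>\<^sub>E i\<in>idx f. fiber i)"
  proof clarify
    fix g assume g: "g \<in> P" "a ` g ` X = a ` f ` X"
    then show "sel g \<in> (\<Pi>\<^sub>E i\<in>idx f. fiber i)"
      using sel_in[OF g(1)] idx_Lhat[of g f] by simp
  qed
next
  fix t assume "t \<in> (\<Pi>\<^sub>E i\<in>idx f. fiber i)"
  then obtain g where "g \<in> P" "a ` g ` X = pt ` idx f" "sel g = t"
    using ex_given_sel[OF f idx_subset card_of_idx[OF f]] by metis
  then show "t \<in> sel ` Lhat f"
    using pt_idx[OF f] by auto
qed

lemma idx_sel_image_Dclass:
  assumes f: "f \<in> P"
  shows "(\<lambda>g. (idx g, sel g)) ` Dclass f =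
    (SIGMA K : {K. K \<subseteq> I \<and> |K| =o |f ` X|}. \<Pi>\<^sub>E i\<in>K. fiber i)"
proof (intro subset_antisym subsetI)
  fix p assume "p \<in> (\<lambda>g. (idx g, sel g)) ` Dclass f"
  then obtain g where g: "g \<in> P" "|g ` X| =o |f ` X|" and p: "p = (idx g, sel g)"
    by blast
  then have "|idx g| =o |f ` X|"
    using card_of_idx ordIso_transitive by blast
  then show "p \<in> (SIGMA K : {K. K \<subseteq> I \<and> |K| =o |f ` X|}. \<Pi>\<^sub>E i\<in>K. fiber i)"
    using p sel_in[OF g(1)] idx_subset by simp
next
  fix p assume "p \<in> (SIGMA K : {K. K \<subseteq> I \<and> |K| =o |f ` X|}. \<Pi>\<^sub>E i\<in>K. fiber i)"
  then obtain K t where p: "p = (K, t)" "K \<subseteq> I" "|K| =o |f ` X|" "t \<in> (\<Pi>\<^sub>E i\<in>K. fiber i)"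
    by blast
  then obtain g where "g \<in> P" "|g ` X| =o |f ` X|" "idx g = K" "sel g = t"
    using ex_given_sel[OF f] by metis
  then show "p \<in> (\<lambda>g. (idx g, sel g)) ` Dclass f"
    using p by blast
qed

lemma sel_eq_iff:
  assumes "g \<in> Lhat f" "h \<in> Lhat f"
  shows "sel g = sel h \<longleftrightarrow> g ` X = h ` X"
  using idx_sel_eq_iff[of g h] assms idx_Lhat[OF assms(1)] idx_Lhat[OF assms(2)] by simp

section \<open>Counting the classes inside hat classes and inside a class of fixed rank\<close>

lemma union_of_green_L_Lhat:
  assumes f: "f \<in> P"
  shows "union_of_classes P (green_L P (\<star>)) |\<Pi>\<^sub>E i\<in>idx f. fiber i| (Lhat f)"
proof (rule union_of_classes_invariant[where F = sel])
  show "green_L P (\<star>) `` Lhat f \<subseteq> Lhat f"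
    by (force simp: green_L_iff)
  show "(g, h) \<in> green_L P (\<star>) \<longleftrightarrow> sel g = sel h" if "g \<in> Lhat f" "h \<in> Lhat f" for g h
    using sel_eq_iff[OF that] that by (simp add: green_L_iff)
qed (auto simp: equiv_green_L sel_image_Lhat[OF f] card_of_refl)

lemma Hhat_eq: "Hhat f = Rhat f \<inter> Lhat f"
  by blast

text \<open>Members of \<open>Rhat f\<close> and of \<open>Lhat f\<close> all have the rank of
  \<open>f\<close>, so the two invariants are independent.\<close>

lemma offset_sel_image:
  assumes f: "f \<in> P"
  shows "(\<lambda>g. (offset f g, sel g)) ` Hhat f = Func (X - A) (f ` X) \<times> (\<Pi>\<^sub>E i\<in>idx f. fiber i)"
  unfolding Hhat_eq offset_image[OF f, symmetric] sel_image_Lhat[OF f, symmetric]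
proof (rule image_pair_invariant)
  show "h \<in> Rhat f" if "g \<in> Rhat f" "h \<in> P" "kernel_on X h = kernel_on X g" for g h
    using kernel_on_mono[OF that(3) A_subset] that by simp
  show "|g ` X| =o |h ` X|" if "g \<in> Rhat f" "h \<in> Lhat f" for g h
  proof -
    have "|g ` X| =o |f ` X|" "|h ` X| =o |f ` X|"
      using card_of_image_Rhat[OF f, of g] card_of_image_Lhat[OF f, of h] that by blast+
    then show ?thesis
      using ordIso_symmetric ordIso_transitive by blast
  qed
  show "offset f g = offset f h" if "g \<in> Rhat f" "h \<in> Rhat f" "kernel_on X g = kernel_on X h" for g h
    using offset_eq_iff[OF that(1,2)] that(3) by simp
  show "sel g = sel h" if "g \<in> Lhat f" "h \<in> Lhat f" "g ` X = h ` X" for g h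
    using sel_eq_iff[OF that(1,2)] that(3) by simp
qed auto

lemma green_H_Hhat_iff:
  assumes "g \<in> Hhat f" "h \<in> Hhat f"
  shows "(g, h) \<in> green_H P (\<star>) \<longleftrightarrow> (offset f g, sel g) = (offset f h, sel h)"
  using offset_eq_iff[of g f h] sel_eq_iff[of g f h] assms by (simp add: green_H_iff)

lemma union_of_green_H_Hhat:
  assumes f: "f \<in> P"
  shows "union_of_classes P (green_H P (\<star>))
    (( |f ` X| ^c |X - A| ) *c |\<Pi>\<^sub>E i\<in>idx f. fiber i| ) (Hhat f)"
proof (rule union_of_classes_invariant[where F = "\<lambda>g. (offset f g, sel g)"])
  show "green_H P (\<star>) `` Hhat f \<subseteq> Hhat f"
  proof clarify
    fix g h assume "g \<in> P" "kernel_on A g = kernel_on A f" "a ` g ` X = a ` f ` X"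
      and "(g, h) \<in> green_H P (\<star>)"
    then show "h \<in> P \<and> kernel_on A h = kernel_on A f \<and> a ` h ` X = a ` f ` X"
      using green_H_subset_Hhat[of g f] by blast
  qed
  show "(g, h) \<in> green_H P (\<star>) \<longleftrightarrow> (offset f g, sel g) = (offset f h, sel h)"
    if "g \<in> Hhat f" "h \<in> Hhat f" for g h
    using green_H_Hhat_iff[OF that] .
qed (auto simp: equiv_green_H offset_sel_image[OF f] cprod_def cexp_def Field_card_of card_of_refl)

lemma union_of_green_R_Dclass:
  assumes f: "f \<in> P"
  shows "union_of_classes P (green_R P (\<star>))
    (( |f ` X| ^c |X - A| ) *c card_Stirling |A| |f ` X| ) (Dclass f)"
proof (rule union_of_classes_invariant[where F = "kernel_invariant f"])
  show "green_R P (\<star>) `` Dclass f \<subseteq> Dclass f"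
  proof clarify
    fix g h assume "g \<in> P" "|g ` X| =o |f ` X|" and "(g, h) \<in> green_R P (\<star>)"
    then show "h \<in> P \<and> |h ` X| =o |f ` X|"
      using Dclass_closed[of g f h] card_of_image_kernel_on[of X g h] by (simp add: green_R_iff)
  qed
  show "(g, h) \<in> green_R P (\<star>) \<longleftrightarrow> kernel_invariant f g = kernel_invariant f h"
    if "g \<in> Dclass f" "h \<in> Dclass f" for g h
    using kernel_invariant_eq_iff[OF f that] that by (simp add: green_R_iff)
qed (auto simp: equiv_green_R kernel_invariant_image[OF f] cprod_def cexp_def card_Stirling_def
    Field_card_of card_of_refl)

lemma union_of_green_L_Dclass:
  assumes f: "f \<in> P"
  shows "union_of_classes P (green_L P (\<star>))
    (CSUM K : |{K. K \<subseteq> I \<and> |K| =o |f ` X|}|. |\<Pi>\<^sub>E i\<in>K. fiber i| ) (Dclass f)"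
proof (rule union_of_classes_invariant[where F = "\<lambda>g. (idx g, sel g)"])
  show "green_L P (\<star>) `` Dclass f \<subseteq> Dclass f"
    by (force simp: green_L_iff)
  show "(g, h) \<in> green_L P (\<star>) \<longleftrightarrow> (idx g, sel g) = (idx h, sel h)"
    if "g \<in> Dclass f" "h \<in> Dclass f" for g h
    using idx_sel_eq_iff[of g h] that by (simp add: green_L_iff)
qed (auto simp: equiv_green_L idx_sel_image_Dclass[OF f] Csum_def Field_card_of card_of_refl)

lemma union_of_green_H_Dclass:
  assumes f: "f \<in> P"
  shows "union_of_classes P (green_H P (\<star>))
    ((( |f ` X| ^c |X - A| ) *c card_Stirling |A| |f ` X| ) *c
      (CSUM K : |{K. K \<subseteq> I \<and> |K| =o |f ` X|}|. |\<Pi>\<^sub>E i\<in>K. fiber i| )) (Dclass f)"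
proof (rule union_of_classes_invariant[where F = "\<lambda>g. (kernel_invariant f g, (idx g, sel g))"])
  have closed: "h \<in> Dclass f" if "g \<in> Dclass f" "h \<in> P" "kernel_on X h = kernel_on X g" for g h
    using Dclass_closed[OF that(1,2)] card_of_image_kernel_on[OF that(3)] ordIso_symmetric by blast
  show "green_H P (\<star>) `` Dclass f \<subseteq> Dclass f"
    by (force simp: green_H_iff)
  show "(g, h) \<in> green_H P (\<star>) \<longleftrightarrow>
      (kernel_invariant f g, (idx g, sel g)) = (kernel_invariant f h, (idx h, sel h))"
    if "g \<in> Dclass f" "h \<in> Dclass f" for g h
    using kernel_invariant_eq_iff[OF f that] idx_sel_eq_iff[of g h] that by (simp add: green_H_iff)
  \<comment> \<open>Writing the rank class as an intersection with itself brings the independence of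
    kernel and image invariants to bear.\<close>
  have "(\<lambda>g. (kernel_invariant f g, (idx g, sel g))) ` (Dclass f \<inter> Dclass f) =
      kernel_invariant f ` Dclass f \<times> (\<lambda>g. (idx g, sel g)) ` Dclass f"
  proof (rule image_pair_invariant)
    show "|g ` X| =o |h ` X|" if "g \<in> Dclass f" "h \<in> Dclass f" for g h
      using that ordIso_symmetric ordIso_transitive by blast
    show "kernel_invariant f g = kernel_invariant f h"
      if "g \<in> Dclass f" "h \<in> Dclass f" "kernel_on X g = kernel_on X h" for g h
      using kernel_invariant_eq_iff[OF f that(1,2)] that(3) by simp
    show "(idx g, sel g) = (idx h, sel h)"
      if "g \<in> Dclass f" "h \<in> Dclass f" "g ` X = h ` X" for g h
      using idx_sel_eq_iff[of g h] that by simp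
  qed (use closed in auto)
  then show "|(\<lambda>g. (kernel_invariant f g, (idx g, sel g))) ` Dclass f| =o
      (( |f ` X| ^c |X - A| ) *c card_Stirling |A| |f ` X| ) *c
      (CSUM K : |{K. K \<subseteq> I \<and> |K| =o |f ` X|}|. |\<Pi>\<^sub>E i\<in>K. fiber i| )"
    by (simp add: kernel_invariant_image[OF f] idx_sel_image_Dclass[OF f] cprod_def cexp_def
        card_Stirling_def Csum_def Field_card_of card_of_refl)
qed (auto simp: equiv_green_H)

section \<open>The rectangular group structure of a group hat class\<close>

text \<open>The coordinates of \<open>g\<close> are its permutation, its offset and its selection.
  In a product the permutations multiply, the offset comes from the left factor with the kernel, and
  the selection from the right factor with the image.\<close>

lemma rectangular_group_Hhat:
  assumes f: "f \<in> P" "transversal_image f"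
  shows "is_rectangular_group ( |f ` X| ^c |X - A| ) |\<Pi>\<^sub>E i\<in>idx f. fiber i|
    (BijGroup (f ` X)) (Hhat f) (\<star>)"
proof -
  let ?N = "a ` f ` X" and ?M = "f ` X"
  let ?U = "Func (X - A) ?M" and ?V = "\<Pi>\<^sub>E i\<in>idx f. fiber i"
  have "bij_betw (inv_into ?M a) ?N ?M"
    using inj_on_imp_bij_betw[OF P_inj[OF f(1)]] by (rule bij_betw_inv_into)
  then obtain d where d: "bij_betw d (Bij ?N) (Bij ?M)"
    and d_mult: "\<And>p q. p \<in> Bij ?N \<Longrightarrow> q \<in> Bij ?N \<Longrightarrow>
      d (compose ?N p q) = d q \<otimes>\<^bsub>BijGroup ?M\<^esub> d p"
    using BijGroup_anti_iso by blast
  let ?h = "\<lambda>g. (d (act ?N g), (offset f g, sel g))"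
  note act = act_Hhat[OF f]
  have H: "h \<in> green_H P (\<star>) `` {g} \<longleftrightarrow> (offset f g, sel g) = (offset f h, sel h)"
    if "g \<in> Hhat f" "h \<in> Hhat f" for g h
    using green_H_Hhat_iff[OF that] by simp
  \<comment> \<open>Equal offset and selection place both maps in one \<H>-class, on which the
    action is injective.\<close>
  have "inj_on ?h (Hhat f)"
  proof (rule inj_onI)
    fix g k assume g: "g \<in> Hhat f" and k: "k \<in> Hhat f" and eq: "?h g = ?h k"
    have "act ?N g = act ?N k"
      using d act[OF g] act[OF k] eq by (auto simp: bij_betw_def dest: inj_onD)
    moreover have "k \<in> green_H P (\<star>) `` {g}" "g \<in> green_H P (\<star>) `` {g}"
      using H[OF g k] H[OF g g] eq by simp_all
    ultimately show "g = k"
      using act_bij_betw_green_H[OF f g] by (auto simp: bij_betw_def dest: inj_onD)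
  qed
  moreover have "?h ` Hhat f = Bij ?M \<times> (?U \<times> ?V)"
  proof (intro subset_antisym subsetI)
    fix w assume "w \<in> ?h ` Hhat f"
    then obtain g where g: "g \<in> Hhat f" and w: "w = ?h g"
      by blast
    have "(offset f g, sel g) \<in> ?U \<times> ?V"
      using g unfolding offset_sel_image[OF f(1), symmetric] by (rule imageI)
    then show "w \<in> Bij ?M \<times> (?U \<times> ?V)"
      using w d act[OF g] by (auto simp: bij_betw_def)
  next
    fix w assume "w \<in> Bij ?M \<times> (?U \<times> ?V)"
    then obtain q v where w: "w = (q, v)" and q: "q \<in> Bij ?M" and v: "v \<in> ?U \<times> ?V"
      by blast
    obtain p where p: "p \<in> Bij ?N" "q = d p"
      using d q by (metis bij_betw_def imageE)
    obtain g where g: "g \<in> Hhat f" "v = (offset f g, sel g)"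
      using v unfolding offset_sel_image[OF f(1), symmetric] by blast
    \<comment> \<open>Moving inside the \<H>-class of \<open>g\<close> adjusts the permutation and
      leaves the other two coordinates unchanged.\<close>
    obtain k where k: "k \<in> green_H P (\<star>) `` {g}" "act ?N k = p"
      using act_bij_betw_green_H[OF f g(1)] p(1) by (metis bij_betw_def imageE)
    then have kH: "k \<in> Hhat f"
      using green_H_subset_Hhat[OF g(1)] by blast
    then have "?h k = w"
      using H[OF g(1) kH] k w g(2) p(2) by simp
    then show "w \<in> ?h ` Hhat f"
      using kH by blast
  qed
  ultimately have bij: "bij_betw ?h (Hhat f) (Bij ?M \<times> (?U \<times> ?V))"
    by (simp add: bij_betw_def)
  have hom: "?h (g \<star> k) = prod_mult (mult (BijGroup ?M)) rect_band_mult (?h g) (?h k)"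
    if g: "g \<in> Hhat f" and k: "k \<in> Hhat f" for g k
  proof -
    note gk = star_Hhat[OF f g k]
    have "offset f (g \<star> k) = offset f g"
      using offset_eq_iff[of "g \<star> k" f g] gk(1,3) g by simp
    moreover have "sel (g \<star> k) = sel k"
      using sel_eq_iff[of "g \<star> k" f k] gk(2,3) k by simp
    ultimately show ?thesis
      using act_star_Hhat[OF f g, of k] d_mult[OF act[OF k] act[OF g]]
      by (simp add: prod_mult_def rect_band_mult_def)
  qed
  have "is_semigroup (Hhat f) (\<star>)"
    unfolding is_semigroup_def
  proof (intro conjI ballI)
    fix g h assume g: "g \<in> Hhat f" and h: "h \<in> Hhat f"
    show "g \<star> h \<in> Hhat f"
      using star_Hhat(3)[OF f g h] .
    show "g \<star> h \<star> k = g \<star> (h \<star> k)" for k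
      using g h by (intro star_assoc P_in) auto
  qed
  moreover have "is_semigroup (Bij ?M \<times> (?U \<times> ?V)) (prod_mult (mult (BijGroup ?M)) rect_band_mult)"
    unfolding is_semigroup_def prod_mult_def rect_band_mult_def
    by (auto simp: compose_Bij Bij_imp_funcset compose_assoc[symmetric])
  ultimately have "semigroup_iso (Hhat f) (\<star>) (Bij ?M \<times> (?U \<times> ?V))
      (prod_mult (mult (BijGroup ?M)) rect_band_mult)"
    unfolding semigroup_iso_def by (intro conjI exI[of _ ?h] ballI bij hom)
  then show ?thesis
    by (simp add: is_rectangular_group_def cexp_def Field_card_of)
qed

end

section \<open>Class counts and group structure for a given regular map\<close>

theorem theorem3p6:
  fixes X :: "'x set" and Y :: "'y set" and a :: "'y \<Rightarrow> 'x"
    and I :: "'i set" and pt :: "'i \<Rightarrow> 'x" and A :: "'x set" and B :: "'i \<Rightarrow> 'y set"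
    and lambda :: "'i \<Rightarrow> 'y rel" and Lambda :: "'i set \<Rightarrow> ('i \<Rightarrow> 'y) rel"
    and alpha :: "'x rel" and beta :: "'x rel" and mu :: "'y rel"
    and P :: "('x \<Rightarrow> 'y) set" and star :: "('x \<Rightarrow> 'y) \<Rightarrow> ('x \<Rightarrow> 'y) \<Rightarrow> ('x \<Rightarrow> 'y)"
    and f :: "'x \<Rightarrow> 'y" and J :: "'i set" and fpt :: "'i \<Rightarrow> 'y"
    and TA :: "('x \<Rightarrow> 'x) set" and tm :: "('x \<Rightarrow> 'x) \<Rightarrow> ('x \<Rightarrow> 'x) \<Rightarrow> ('x \<Rightarrow> 'x)"
  assumes "X \<noteq> {}" and "Y \<noteq> {}" and "a \<in> Y \<rightarrow>\<^sub>E X"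
    and "A = a ` Y" and "bij_betw pt I A"
    and "\<And>i. B i = {y \<in> Y. a y = pt i}"
    and "\<And>i. lambda i = |B i|"
    and "\<And>K. Lambda K = card_Prod K lambda"
    and "alpha = |a ` Y|" and "beta = |X - a ` Y|"
    and "P = reg_sandwich X Y a" and "star = sandwich_mult X a"
    and "TA = (A \<rightarrow>\<^sub>E A)" and "tm = trans_mult A"
    and "f \<in> P" and "J \<subseteq> I" and "bij_betw fpt J (f ` X)" and "\<And>j. j \<in> J \<Longrightarrow> fpt j \<in> B j"
    and "mu = |f ` X|"
  shows
    \<comment> \<open>every element of P has the form required of f\<close>
    "(\<forall>g\<in>P. \<exists>K\<subseteq>I. \<exists>gpt. bij_betw gpt K (g ` X) \<and> (\<forall>k\<in>K. gpt k \<in> B k))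
     \<and>
     \<comment> \<open>(i)\<close>
     union_of_classes P (green_R P star) (mu ^c beta) (hat_rel X Y a green_R `` {f})
     \<and>
     \<comment> \<open>(ii)\<close>
     union_of_classes P (green_L P star) (Lambda J) (hat_rel X Y a green_L `` {f})
     \<and>
     \<comment> \<open>(iii)\<close>
     (union_of_classes P (green_H P star) ((mu ^c beta) *c Lambda J) (hat_rel X Y a green_H `` {f})
      \<and> (\<forall>H \<in> P // green_H P star. H \<subseteq> hat_rel X Y a green_H `` {f} \<longrightarrow> |H| =o card_fact mu))
     \<and>
     \<comment> \<open>(iv)\<close>
     (\<not> is_group (green_H TA tm `` {bar Y a f}) tm \<longrightarrow>
        (\<forall>H \<in> P // green_H P star. H \<subseteq> hat_rel X Y a green_H `` {f} \<longrightarrow> \<not> is_group H star))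
     \<and>
     \<comment> \<open>(v)\<close>
     (is_group (green_H TA tm `` {bar Y a f}) tm \<longrightarrow>
        (\<forall>H \<in> P // green_H P star. H \<subseteq> hat_rel X Y a green_H `` {f} \<longrightarrow>
           is_group_iso H star (BijGroup (Field mu)))
        \<and> is_rectangular_group (mu ^c beta) (Lambda J) (BijGroup (Field mu))
            (hat_rel X Y a green_H `` {f}) star)
     \<and>
     \<comment> \<open>(vi)\<close>
     (hat_rel X Y a green_D `` {f} = green_D P star `` {f}
      \<and> green_D P star `` {f} = {g \<in> P. |g ` X| =o mu}
      \<and> union_of_classes P (green_R P star) ((mu ^c beta) *c card_Stirling alpha mu)
          (hat_rel X Y a green_D `` {f})
      \<and> union_of_classes P (green_L P star) (CSUM K : |{K. K \<subseteq> I \<and> |K| =o mu}|. Lambda K)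
          (hat_rel X Y a green_D `` {f})
      \<and> union_of_classes P (green_H P star)
          (((mu ^c beta) *c card_Stirling alpha mu) *c (CSUM K : |{K. K \<subseteq> I \<and> |K| =o mu}|. Lambda K))
          (hat_rel X Y a green_D `` {f}))"
proof -
  interpret sandwich_indexed X Y a I pt
    using assms(3-5) by unfold_locales auto
  have A: "A = a ` Y" and P: "P = reg_sandwich X Y a" and star: "star = sandwich_mult X a"
    and f: "f \<in> reg_sandwich X Y a" and mu: "mu = |f ` X|"
    and alpha: "alpha = |a ` Y|" and beta: "beta = |X - a ` Y|"
    using assms by simp_all
  have TA: "TA = (a ` Y \<rightarrow>\<^sub>E a ` Y)" "tm = trans_mult (a ` Y)"
    using assms by simp_all
  have B: "B = fiber"
    using assms(6) by (auto simp: fiber_def)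
  have Lambda: "Lambda = (\<lambda>K. |\<Pi>\<^sub>E i\<in>K. fiber i| )"
    using assms(7,8) B by (auto simp: card_Prod_def Field_card_of)
  \<comment> \<open>The given indexing of the image forces \<open>J\<close>: applying
    \<open>a\<close> to its values yields exactly the points \<open>pt j\<close>.\<close>
  have J: "J = idx f"
  proof -
    have "f ` X = fpt ` J"
      using assms(17) by (simp add: bij_betw_def)
    moreover have "a (fpt j) = pt j" if "j \<in> J" for j
      using assms(18)[OF that] by (simp add: assms(6))
    ultimately have "a ` f ` X = pt ` J"
      by (simp add: image_image)
    then show ?thesis
      using \<open>J \<subseteq> I\<close> pt_eq by (auto simp: idx_def)
  qed
  have form: "\<exists>K\<subseteq>I. \<exists>gpt. bij_betw gpt K (g ` X) \<and> (\<forall>k\<in>K. gpt k \<in> fiber k)"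
    if "g \<in> reg_sandwich X Y a" for g
    using sel_bij_betw[OF that] sel_in[OF that] idx_subset[of g] by blast
  have class_hat_H: "\<exists>g \<in> Hhat f. H = green_H (reg_sandwich X Y a) (sandwich_mult X a) `` {g}"
    if H: "H \<in> reg_sandwich X Y a // green_H (reg_sandwich X Y a) (sandwich_mult X a)" and "H \<subseteq> Hhat f" for H
  proof -
    obtain g where g: "g \<in> reg_sandwich X Y a"
      "H = green_H (reg_sandwich X Y a) (sandwich_mult X a) `` {g}"
      using H by (rule quotientE)
    then have "g \<in> H"
      using equiv_class_self[OF equiv_green_H] by blast
    then show ?thesis
      using g \<open>H \<subseteq> Hhat f\<close> by blast
  qed
  have size: "|H| =o card_fact mu"
    if H: "H \<in> reg_sandwich X Y a // green_H (reg_sandwich X Y a) (sandwich_mult X a)" "H \<subseteq> Hhat f" for H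
  proof -
    obtain g where g: "g \<in> Hhat f" "H = green_H (reg_sandwich X Y a) (sandwich_mult X a) `` {g}"
      using class_hat_H[OF H] by blast
    \<comment> \<open>The class of \<open>g\<close> is counted by permutations of the image of
      \<open>g\<close>; equal rank moves the count to the image of \<open>f\<close>.\<close>
    have "|g ` X| =o |f ` X|"
      using card_of_image_Rhat[OF f, of g] g(1) by blast
    then obtain b where "bij_betw b (g ` X) (f ` X)"
      using card_of_ordIso by blast
    then obtain d where "bij_betw d (Bij (g ` X)) (Bij (f ` X))"
      using BijGroup_anti_iso by blast
    then have "|Bij (g ` X)| =o |Bij (f ` X)|"
      using card_of_ordIso by blast
    moreover have "|H| =o |Bij (g ` X)|"
      using card_of_green_H[of g] g by simp
    ultimately show ?thesis
      using ordIso_transitive by (simp add: mu card_fact_def Field_card_of)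
  qed
  note transversal = transversal_image_iff_bar[OF f, folded TA]
  have non_group: "\<not> is_group H (sandwich_mult X a)"
    if "\<not> transversal_image f"
      and H: "H \<in> reg_sandwich X Y a // green_H (reg_sandwich X Y a) (sandwich_mult X a)" "H \<subseteq> Hhat f" for H
  proof
    assume "is_group H (sandwich_mult X a)"
    moreover obtain g where g: "g \<in> Hhat f" "H = green_H (reg_sandwich X Y a) (sandwich_mult X a) `` {g}"
      using class_hat_H[OF H] by blast
    ultimately have "transversal_image g"
      using is_group_imp_transversal_image[of g] by simp
    then show False
      using transversal_image_cong[OF f, of g] g(1) \<open>\<not> transversal_image f\<close> by blast
  qed
  have group: "is_group_iso H (sandwich_mult X a) (BijGroup (f ` X))"
    if "transversal_image f"
      and H: "H \<in> reg_sandwich X Y a // green_H (reg_sandwich X Y a) (sandwich_mult X a)" "H \<subseteq> Hhat f" for H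
    using class_hat_H[OF H] transversal_image_imp_group_iso[OF f \<open>transversal_image f\<close>] by blast
  show ?thesis
    unfolding P star hat_R[OF f] hat_L[OF f] hat_H[OF f] hat_D[OF f] green_D_Image[OF f]
      transversal[symmetric] B J Lambda alpha beta
    by (intro conjI impI ballI)
      (use form size non_group group rectangular_group_Hhat[OF f] union_of_green_R_Rhat[OF f]
        union_of_green_L_Lhat[OF f] union_of_green_H_Hhat[OF f] union_of_green_R_Dclass[OF f]
        union_of_green_L_Dclass[OF f] union_of_green_H_Dclass[OF f]
        in \<open>simp_all add: mu Field_card_of\<close>)
qed

end
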